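(* Let $X$ be an irreducible sofic shift and $\pi: X\to Y$ a finite-to-one factor code. Let $\nu$ be a fully supported ergodic measure on $Y$ and $\lambda$ a degree joining over $\nu$. Then $$\{p_i\lambda: 1\le i\le d_\pi\}$$ is the set of all ergodic measures $\mu$ on $X$ with $\pi\mu=\nu$.
   Context: Shift spaces are two-sided with finite alphabet; "measure" means Borel probability measure, and "ergodic measure" means an ergodic shift-invariant measure. A factor code is a shift-commuting continuous surjection between shift spaces. For a finite-to-one factor code $\pi$ on an irreducible sofic shift, every doubly transitive point of $Y$ has the same finite number of preimages; this number is the degree $d_\pi$. An $n$-fold ($\pi$-)relative joining is a measure $\lambda$ on $X^n$, invariant under the product (diagonal) shift action, such that the set $X^n_\pi=\{(x^{(1)},\dots,x^{(n)})\in X^n:\pi(x^{(1)})=\dots=\pi(x^{(n)})\}$ has full $\lambda$-measure. With $p_i:X^n\to X$ the $i$-th coordinate projection, it is a relative joining over $\nu$ if $\pi p_i\lambda=\nu$ for some (hence every) $i$ (maps applied to measures mean pushforward; $p_i\lambda$ is the $i$-th margin). It is separating if for $\lambda$-a.e. $(x^{(1)},\dots,x^{(n)})$ the points $x^{(1)},\dots,x^{(n)}$ are $n$ distinct points. A degree joining over $\nu$ (with respect to $\pi$) is an ergodic $d_\pi$-fold separating relative joining over $\nu$. *)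

theory Defs
  imports "HOL-Probability.Probability"
begin

section \<open>Shift spaces\<close>

definition shift :: "(int \<Rightarrow> 'a) \<Rightarrow> int \<Rightarrow> 'a" where
  "shift x = (\<lambda>i. x (i + 1))"

text \<open>
  The topology on \<^typ>\<open>int \<Rightarrow> 'a\<close> is the product of the discrete topologies. The symbol type need
  not be finite; each shift space uses only symbols from some finite alphabet.
\<close>
definition shift_space :: "(int \<Rightarrow> 'a::discrete_topology) set \<Rightarrow> bool" where
  "shift_space X \<longleftrightarrow>
     (\<exists>A. finite A \<and> (\<forall>x\<in>X. range x \<subseteq> A)) \<and> closed X \<and> shift ` X = X"

definition occurs_at :: "'a list \<Rightarrow> (int \<Rightarrow> 'a) \<Rightarrow> int \<Rightarrow> bool" where
  "occurs_at w x i \<longleftrightarrow> (\<forall>k<length w. x (i + int k) = w ! k)"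

definition language :: "(int \<Rightarrow> 'a) set \<Rightarrow> 'a list set" where
  "language X = {w. \<exists>x\<in>X. \<exists>i. occurs_at w x i}"

definition irreducible_shift :: "(int \<Rightarrow> 'a) set \<Rightarrow> bool" where
  "irreducible_shift X \<longleftrightarrow>
     (\<forall>u\<in>language X. \<forall>v\<in>language X. \<exists>w. u @ w @ v \<in> language X)"

definition shift_of_finite_type :: "(int \<Rightarrow> 'a) set \<Rightarrow> bool" where
  "shift_of_finite_type X \<longleftrightarrow>
     (\<exists>A F. finite A \<and> finite F \<and>
        X = {x. range x \<subseteq> A \<and> (\<forall>w\<in>F. \<forall>i. \<not> occurs_at w x i)})"

definition factor_code ::
  "(int \<Rightarrow> 'a::discrete_topology) set \<Rightarrow> (int \<Rightarrow> 'b::discrete_topology) set \<Rightarrow>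
    ((int \<Rightarrow> 'a) \<Rightarrow> int \<Rightarrow> 'b) \<Rightarrow> bool" where
  "factor_code X Y \<pi> \<longleftrightarrow>
     shift_space X \<and> shift_space Y \<and>
     continuous_on X \<pi> \<and> \<pi> ` X = Y \<and> (\<forall>x\<in>X. \<pi> (shift x) = shift (\<pi> x))"

text \<open>
  A sofic shift is a factor of a shift of finite type. Since every finite alphabet can be renamed
  into the natural numbers, it suffices to let the shift of finite type range over subsets of
  \<^typ>\<open>int \<Rightarrow> nat\<close>.
\<close>
definition sofic :: "(int \<Rightarrow> 'a::discrete_topology) set \<Rightarrow> bool" where
  "sofic X \<longleftrightarrow>
     (\<exists>(Z :: (int \<Rightarrow> nat) set) \<phi>. shift_of_finite_type Z \<and> factor_code Z X \<phi>)"

definition doubly_transitive :: "(int \<Rightarrow> 'a) set \<Rightarrow> (int \<Rightarrow> 'a) \<Rightarrow> bool" where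
  "doubly_transitive X x \<longleftrightarrow>
     x \<in> X \<and> (\<forall>w\<in>language X. \<forall>n. (\<exists>i\<ge>n. occurs_at w x i) \<and> (\<exists>i\<le>n. occurs_at w x i))"

definition fiber :: "(int \<Rightarrow> 'a) set \<Rightarrow> ((int \<Rightarrow> 'a) \<Rightarrow> int \<Rightarrow> 'b) \<Rightarrow> (int \<Rightarrow> 'b) \<Rightarrow> (int \<Rightarrow> 'a) set" where
  "fiber X \<pi> y = {x \<in> X. \<pi> x = y}"

definition finite_to_one ::
  "(int \<Rightarrow> 'a) set \<Rightarrow> (int \<Rightarrow> 'b) set \<Rightarrow> ((int \<Rightarrow> 'a) \<Rightarrow> int \<Rightarrow> 'b) \<Rightarrow> bool" where
  "finite_to_one X Y \<pi> \<longleftrightarrow> (\<forall>y\<in>Y. finite (fiber X \<pi> y))"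

text \<open>
  The common number of preimages of the doubly transitive points. It is well defined when
  \<open>\<pi>\<close> is a finite-to-one factor code on a nonempty irreducible sofic shift.
\<close>
definition code_degree ::
  "(int \<Rightarrow> 'a) set \<Rightarrow> (int \<Rightarrow> 'b) set \<Rightarrow> ((int \<Rightarrow> 'a) \<Rightarrow> int \<Rightarrow> 'b) \<Rightarrow> nat" where
  "code_degree X Y \<pi> =
     (THE d. \<forall>y. doubly_transitive Y y \<longrightarrow> finite (fiber X \<pi> y) \<and> card (fiber X \<pi> y) = d)"


section \<open>Invariant and ergodic measures\<close>

definition invariant_prob :: "'c measure \<Rightarrow> ('c \<Rightarrow> 'c) \<Rightarrow> 'c measure \<Rightarrow> bool" where
  "invariant_prob S T M \<longleftrightarrow>
     prob_space M \<and> sets M = sets S \<and> T \<in> measurable S S \<and> distr M S T = M"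

definition ergodic_prob :: "'c measure \<Rightarrow> ('c \<Rightarrow> 'c) \<Rightarrow> 'c measure \<Rightarrow> bool" where
  "ergodic_prob S T M \<longleftrightarrow>
     invariant_prob S T M \<and>
     (\<forall>E\<in>sets S. T -` E \<inter> space S = E \<longrightarrow> measure M E = 0 \<or> measure M E = 1)"

definition borel_on :: "'c::topological_space set \<Rightarrow> 'c measure" where
  "borel_on X = restrict_space borel X"

definition ergodic_measure ::
  "(int \<Rightarrow> 'a::discrete_topology) set \<Rightarrow> (int \<Rightarrow> 'a) measure \<Rightarrow> bool" where
  "ergodic_measure X \<mu> \<longleftrightarrow> ergodic_prob (borel_on X) shift \<mu>"

definition fully_supported :: "'c::topological_space set \<Rightarrow> 'c measure \<Rightarrow> bool" where
  "fully_supported X \<mu> \<longleftrightarrow> (\<forall>U. open U \<longrightarrow> U \<inter> X \<noteq> {} \<longrightarrow> measure \<mu> (U \<inter> X) > 0)"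


section \<open>Relative joinings\<close>

text \<open>
  The power \<open>X\<^sup>n\<close> is represented by the extensional functions \<open>{1..n} \<rightarrow>\<^sub>E X\<close>. Shift spaces being
  second countable, the product of the Borel sigma-algebras is the Borel sigma-algebra of the
  product topology on \<open>X\<^sup>n\<close>.
\<close>
definition borel_power ::
  "(int \<Rightarrow> 'a::discrete_topology) set \<Rightarrow> nat \<Rightarrow> (nat \<Rightarrow> int \<Rightarrow> 'a) measure" where
  "borel_power X n = PiM {1..n} (\<lambda>_. borel_on X)"

definition diagonal_shift :: "nat \<Rightarrow> (nat \<Rightarrow> int \<Rightarrow> 'a) \<Rightarrow> nat \<Rightarrow> int \<Rightarrow> 'a" where
  "diagonal_shift n z = (\<lambda>i\<in>{1..n}. shift (z i))"

definition relative_joining ::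
  "(int \<Rightarrow> 'a::discrete_topology) set \<Rightarrow> ((int \<Rightarrow> 'a) \<Rightarrow> int \<Rightarrow> 'b) \<Rightarrow> nat \<Rightarrow>
    (nat \<Rightarrow> int \<Rightarrow> 'a) measure \<Rightarrow> bool" where
  "relative_joining X \<pi> n \<Lambda> \<longleftrightarrow>
     invariant_prob (borel_power X n) (diagonal_shift n) \<Lambda> \<and>
     (AE z in \<Lambda>. \<forall>i\<in>{1..n}. \<forall>j\<in>{1..n}. \<pi> (z i) = \<pi> (z j))"

definition margin ::
  "(int \<Rightarrow> 'a::discrete_topology) set \<Rightarrow> nat \<Rightarrow> (nat \<Rightarrow> int \<Rightarrow> 'a) measure \<Rightarrow> (int \<Rightarrow> 'a) measure" where
  "margin X i \<Lambda> = distr \<Lambda> (borel_on X) (\<lambda>z. z i)"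

definition relative_joining_over ::
  "(int \<Rightarrow> 'a::discrete_topology) set \<Rightarrow> (int \<Rightarrow> 'b::discrete_topology) set \<Rightarrow>
    ((int \<Rightarrow> 'a) \<Rightarrow> int \<Rightarrow> 'b) \<Rightarrow> nat \<Rightarrow> (int \<Rightarrow> 'b) measure \<Rightarrow> (nat \<Rightarrow> int \<Rightarrow> 'a) measure \<Rightarrow> bool" where
  "relative_joining_over X Y \<pi> n \<nu> \<Lambda> \<longleftrightarrow>
     relative_joining X \<pi> n \<Lambda> \<and>
     (\<exists>i\<in>{1..n}. distr (margin X i \<Lambda>) (borel_on Y) \<pi> = \<nu>)"

definition separating :: "nat \<Rightarrow> (nat \<Rightarrow> int \<Rightarrow> 'a) measure \<Rightarrow> bool" where
  "separating n \<Lambda> \<longleftrightarrow> (AE z in \<Lambda>. inj_on z {1..n})"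

definition degree_joining ::
  "(int \<Rightarrow> 'a::discrete_topology) set \<Rightarrow> (int \<Rightarrow> 'b::discrete_topology) set \<Rightarrow>
    ((int \<Rightarrow> 'a) \<Rightarrow> int \<Rightarrow> 'b) \<Rightarrow> (int \<Rightarrow> 'b) measure \<Rightarrow> (nat \<Rightarrow> int \<Rightarrow> 'a) measure \<Rightarrow> bool" where
  "degree_joining X Y \<pi> \<nu> \<Lambda> \<longleftrightarrow>
     (let d = code_degree X Y \<pi> in
       relative_joining_over X Y \<pi> d \<nu> \<Lambda> \<and> separating d \<Lambda> \<and>
       ergodic_prob (borel_power X d) (diagonal_shift d) \<Lambda>)"

end

theory Submission
  imports Defs "HOL-Library.Sublist"
begin

text \<open>
  Let \<open>d\<close> be the degree and \<open>m 1, ..., m d\<close> the margins of the degree joining. Ergodicity passes from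
  the joining to its margins (\<open>margin_ergodic\<close>), and all of them lie over \<open>\<nu>\<close> because the coordinates
  have the same image almost surely.

  For the converse let \<open>\<mu>\<close> be ergodic over \<open>\<nu>\<close>. As \<open>\<nu>\<close> is ergodic and fully supported, almost every
  point of \<open>Y\<close> is doubly transitive (\<open>AE_doubly_transitive\<close>) and so has exactly \<open>d\<close> preimages. The \<open>d\<close>
  coordinates of almost every point of the joining are distinct preimages of one point, hence they
  are all of its preimages. It follows that \<open>\<mu> C \<le> m 1 C + ... + m d C\<close> for closed \<open>C\<close>: both sides are
  compared with the probability that the fibre meets \<open>C\<close> (\<open>measure_le_sum_margins\<close>). Distinct ergodic
  measures are mutually singular, so if \<open>\<mu>\<close> were none of the margins, a clopen approximation of a set
  that is full for \<open>\<mu>\<close> and null for the margins would violate this inequality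
  (\<open>ergodic_dominated_by_finite_sum\<close>).

  The larger part of the work is to show that the degree makes sense: all doubly transitive points
  of \<open>Y\<close> have the same number of preimages (\<open>card_fiber_doubly_transitive_constant\<close>). Points of a
  sofic shift can be spliced along a common occurrence of a synchronizing word \<open>s\<close>, and since \<open>\<pi>\<close> is
  finite-to-one, words that start and end with \<open>s\<close> are determined by their length and image
  (\<open>no_diamond\<close>). By a count of words, some word \<open>u\<close> of \<open>Y\<close> has only preimages that contain \<open>s\<close>
  (\<open>exists_word_forcing_sync\<close>). Both steps rest on the irreducibility of \<open>X\<close>. Now choose a window around \<open>u\<close>
  with the fewest preimage blocks above \<open>u\<close>. Whenever it occurs in a doubly transitive point \<open>y\<close>, each
  of these blocks extends to a preimage of \<open>y\<close> (\<open>preimage_through_block\<close>), and the block determines the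
  preimage to its right (\<open>preimage_determined_by_block\<close>). At an occurrence far to the left the
  preimages of \<open>y\<close> therefore correspond to the blocks, whose number does not depend on \<open>y\<close>.
\<close>

section \<open>Windows, translates and block codes\<close>

definition window :: "(int \<Rightarrow> 'a) \<Rightarrow> int \<Rightarrow> nat \<Rightarrow> 'a list" where
  "window x i n = map (\<lambda>k. x (i + int k)) [0..<n]"

definition translate :: "int \<Rightarrow> (int \<Rightarrow> 'a) \<Rightarrow> int \<Rightarrow> 'a" where
  "translate t x = (\<lambda>i. x (i + t))"

lemma length_window [simp]: "length (window x i n) = n"
  by (simp add: window_def)

lemma nth_window [simp]: "k < n \<Longrightarrow> window x i n ! k = x (i + int k)"
  by (simp add: window_def)

lemma window_eq_iff:
  "window x i n = window y j n \<longleftrightarrow> (\<forall>k\<in>{0..<int n}. x (i + k) = y (j + k))"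
proof -
  have "window x i n = window y j n \<longleftrightarrow> (\<forall>k<n. x (i + int k) = y (j + int k))"
    by (simp add: list_eq_iff_nth_eq)
  also have "\<dots> \<longleftrightarrow> (\<forall>k\<in>{0..<int n}. x (i + k) = y (j + k))"
    by (metis (no_types, lifting) atLeastLessThan_iff of_nat_0_le_iff of_nat_less_iff zero_le_imp_eq_int)
  finally show ?thesis .
qed

lemma window_eq_same_iff:
  "window x i n = window y i n \<longleftrightarrow> (\<forall>k\<in>{i..<i + int n}. x k = y k)"
proof
  assume "window x i n = window y i n"
  then have *: "\<forall>k\<in>{0..<int n}. x (i + k) = y (i + k)" by (simp add: window_eq_iff)
  show "\<forall>k\<in>{i..<i + int n}. x k = y k"
  proof
    fix k assume "k \<in> {i..<i + int n}"
    then show "x k = y k" using *[rule_format, of "k - i"] by simp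
  qed
qed (simp add: window_eq_iff)

lemma occurs_at_iff_window: "occurs_at w x i \<longleftrightarrow> window x i (length w) = w"
  by (auto simp: occurs_at_def list_eq_iff_nth_eq)

lemma occurs_at_window [simp]: "occurs_at (window x i n) x i"
  by (simp add: occurs_at_iff_window)

lemma window_add: "window x i (m + n) = window x i m @ window x (i + int m) n"
  by (auto simp: list_eq_iff_nth_eq nth_append algebra_simps)

lemma window_0 [simp]: "window x i 0 = []" by (simp add: window_def)

lemma occurs_at_append:
  "occurs_at (u @ v) x i \<longleftrightarrow> occurs_at u x i \<and> occurs_at v x (i + int (length u))"
  by (simp add: occurs_at_iff_window window_add append_eq_append_conv)

lemma translate_apply: "translate t x i = x (i + t)"
  by (simp add: translate_def)

lemma translate_translate [simp]: "translate s (translate t x) = translate (s + t) x"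
  by (simp add: translate_def algebra_simps)

lemma translate_0 [simp]: "translate 0 x = x" by (simp add: translate_def)

lemma shift_eq_translate: "shift = translate 1"
  by (simp add: fun_eq_iff shift_def translate_def)

lemma window_translate: "window (translate t x) i n = window x (i + t) n"
  by (simp add: window_def translate_apply algebra_simps)

lemma occurs_at_translate: "occurs_at w (translate t x) i \<longleftrightarrow> occurs_at w x (i + t)"
  by (simp add: occurs_at_iff_window window_translate)

lemma translate_in:
  assumes "shift ` X = X" "x \<in> X"
  shows "translate t x \<in> X"
proof -
  have fwd: "translate (int n) x \<in> X" if "x \<in> X" for x n
  proof (induction n)
    case (Suc n)
    then have "shift (translate (int n) x) \<in> X" using assms(1) by blast
    then show ?case by (simp add: shift_eq_translate)
  qed (simp add: that)
  have bwd: "translate (- int n) x \<in> X" if "x \<in> X" for x n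
  proof (induction n)
    case (Suc n)
    then obtain z where z: "z \<in> X" "translate (- int n) x = shift z" using assms(1) by blast
    have "translate (-1) (translate (- int n) x) = z" using z(2) by (simp add: shift_eq_translate)
    then show ?case using z(1) by simp
  qed (simp add: that)
  show ?thesis using fwd[OF assms(2), of "nat t"] bwd[OF assms(2), of "nat (- t)"]
    by (cases "t \<ge> 0") auto
qed

lemma shift_space_translate_in: "shift_space X \<Longrightarrow> x \<in> X \<Longrightarrow> translate t x \<in> X"
  by (rule translate_in) (auto simp: shift_space_def)

lemma window_in_language: "x \<in> X \<Longrightarrow> window x i n \<in> language X"
  by (auto simp: language_def intro!: bexI[of _ x] exI[of _ i])

lemma language_at:
  assumes "shift_space X" "w \<in> language X"
  obtains x where "x \<in> X" "occurs_at w x i"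
proof -
  obtain x j where "x \<in> X" "occurs_at w x j" using assms by (auto simp: language_def)
  then show ?thesis
    using that[of "translate (j - i) x"] shift_space_translate_in[OF assms(1)]
    by (simp add: occurs_at_translate)
qed

lemma language_appendD:
  assumes "u @ v \<in> language X"
  shows "u \<in> language X" "v \<in> language X"
proof -
  obtain x i where "x \<in> X" "occurs_at u x i" "occurs_at v x (i + int (length u))"
    using assms by (auto simp: language_def occurs_at_append)
  then show "u \<in> language X" "v \<in> language X" unfolding language_def by blast+
qed

lemma open_contains_cylinder:
  assumes "open U" "x \<in> U"
  obtains n :: nat where "\<And>z. (\<forall>i\<in>{- int n..int n}. z i = x i) \<Longrightarrow> z \<in> U"
proof -
  have "openin (product_topology (\<lambda>_. euclidean) UNIV) U"
    using assms(1) by (simp add: open_fun_def)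
  then obtain V where V: "x \<in> PiE UNIV V" "finite {i. V i \<noteq> UNIV}" "PiE UNIV V \<subseteq> U"
    using product_topology_open_contains_basis[of "\<lambda>_. euclidean" UNIV U x] assms(2) by auto
  define n where "n = Max (insert 0 ((\<lambda>i. nat \<bar>i\<bar>) ` {i. V i \<noteq> UNIV}))"
  have n: "i \<in> {- int n..int n}" if "V i \<noteq> UNIV" for i
  proof -
    have "nat \<bar>i\<bar> \<le> n" unfolding n_def using V(2) that by (intro Max_ge) auto
    then show ?thesis by auto
  qed
  show ?thesis
  proof (rule that[of n])
    fix z assume "\<forall>i\<in>{- int n..int n}. z i = x i"
    then have "z \<in> PiE UNIV V" using n V(1) by (metis PiE_UNIV_domain PiE_mem Pi_I UNIV_I)
    then show "z \<in> U" using V(3) by blast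
  qed
qed

lemma open_cylinder:
  fixes x :: "int \<Rightarrow> 'a::discrete_topology"
  assumes "finite I"
  shows "open {z. \<forall>i\<in>I. z i = x i}"
proof -
  have "open ((\<lambda>z::int \<Rightarrow> 'a. z i) -` {x i})" for i
    by (rule open_vimage) (auto intro: discrete_topology_class.open_discrete)
  moreover have "{z. \<forall>i\<in>I. z i = x i} = (\<Inter>i\<in>I. (\<lambda>z::int \<Rightarrow> 'a. z i) -` {x i})" by auto
  ultimately show ?thesis using assms by (simp add: open_INT)
qed

lemma closed_cylinder:
  fixes x :: "int \<Rightarrow> 'a::discrete_topology"
  shows "closed {z. \<forall>i\<in>I. z i = x i}"
proof -
  have "closed ((\<lambda>z::int \<Rightarrow> 'a. z i) -` {x i})" for i
    by (rule closed_vimage) (auto simp: closed_def intro: discrete_topology_class.open_discrete)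
  moreover have "{z. \<forall>i\<in>I. z i = x i} = (\<Inter>i\<in>I. (\<lambda>z::int \<Rightarrow> 'a. z i) -` {x i})" by auto
  ultimately show ?thesis by auto
qed

lemma occurs_at_as_cylinder:
  "{z. occurs_at w z i} = {z. \<forall>k\<in>{i..<i + int (length w)}. z k = w ! nat (k - i)}"
proof -
  have "window z i (length w) = w \<longleftrightarrow> (\<forall>k\<in>{i..<i + int (length w)}. z k = w ! nat (k - i))" for z
  proof -
    have "w = window (\<lambda>k. w ! nat (k - i)) i (length w)" by (auto simp: list_eq_iff_nth_eq)
    then show ?thesis using window_eq_same_iff[of z i "length w" "\<lambda>k. w ! nat (k - i)"] by simp
  qed
  then show ?thesis by (simp add: occurs_at_iff_window)
qed

lemma open_occurs_at: "open {z :: int \<Rightarrow> 'a::discrete_topology. occurs_at w z i}"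
  unfolding occurs_at_as_cylinder by (rule open_cylinder) simp

lemma closed_occurs_at: "closed {z :: int \<Rightarrow> 'a::discrete_topology. occurs_at w z i}"
  unfolding occurs_at_as_cylinder by (rule closed_cylinder)

text \<open>
  A shift space is determined by its language: if all windows of \<open>x\<close> are words of the language,
  then every cylinder around \<open>x\<close> meets \<open>X\<close>, and \<open>X\<close> is closed. Since the language is closed under
  subwords, it is enough to check arbitrarily large windows.
\<close>
lemma in_shift_space_if_windows:
  fixes X :: "(int \<Rightarrow> 'a::discrete_topology) set"
  assumes X: "shift_space X" and w: "\<And>i n. \<exists>j m. j \<le> i \<and> i + int n \<le> j + int m \<and> window x j m \<in> language X"
  shows "x \<in> X"
proof (rule ccontr)
  assume "x \<notin> X"
  moreover have "open (- X)" using X by (simp add: shift_space_def open_Compl)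
  ultimately obtain n where n: "\<And>z. (\<forall>i\<in>{- int n..int n}. z i = x i) \<Longrightarrow> z \<in> - X"
    using open_contains_cylinder[of "- X" x] by auto
  obtain j m where jm: "j \<le> - int n" "- int n + int (2 * n + 1) \<le> j + int m" "window x j m \<in> language X"
    using w[of "- int n" "2 * n + 1"] by blast
  then obtain z where z: "z \<in> X" "occurs_at (window x j m) z j"
    using language_at[OF X] by metis
  then have "\<forall>k\<in>{j..<j + int m}. z k = x k"
    by (simp add: occurs_at_iff_window window_eq_same_iff)
  then have "z \<in> - X" using jm by (intro n) auto
  then show False using z by simp
qed

text \<open>
  Tychonoff: \<open>X\<close> is a closed subset of a power of its finite alphabet.
\<close>
lemma compact_shift_space:
  fixes X :: "(int \<Rightarrow> 'a::discrete_topology) set"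
  assumes "shift_space X"
  shows "compact X"
proof -
  obtain A where A: "finite A" "\<forall>x\<in>X. range x \<subseteq> A" and cl: "closed X"
    using assms by (auto simp: shift_space_def)
  have "compact A" using A(1) by (rule finite_imp_compact)
  then have "compactin (product_topology (\<lambda>_::int. euclidean :: 'a topology) UNIV) (PiE UNIV (\<lambda>_. A))"
    by (simp add: compactin_PiE)
  then have "compact (PiE (UNIV::int set) (\<lambda>_. A))"
    by (simp add: euclidean_product_topology)
  moreover have "X = X \<inter> PiE UNIV (\<lambda>_. A)" using A(2) by (auto simp: PiE_def)
  ultimately show ?thesis using cl by (metis compact_Int_closed Int_commute)
qed

lemma compact_nested_points:
  fixes Q :: "nat \<Rightarrow> 'c::topological_space \<Rightarrow> bool"
  assumes "compact X" and cl: "\<And>n. closed {x\<in>X. Q n x}"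
    and ne: "\<And>n. \<exists>x\<in>X. Q n x" and anti: "\<And>m n x. m \<le> n \<Longrightarrow> Q n x \<Longrightarrow> Q m x"
  shows "\<exists>x\<in>X. \<forall>n. Q n x"
proof -
  have "X \<inter> (\<Inter>n\<in>UNIV. {x\<in>X. Q n x}) \<noteq> {}"
  proof (rule compact_imp_fip_image[OF assms(1) cl])
    fix I :: "nat set" assume "finite I"
    then obtain m where m: "\<forall>i\<in>I. i \<le> m" by (meson finite_nat_set_iff_bounded_le)
    obtain x where "x \<in> X" "Q m x" using ne by blast
    then have "x \<in> X \<inter> (\<Inter>n\<in>I. {x\<in>X. Q n x})" using m anti by blast
    then show "X \<inter> (\<Inter>n\<in>I. {x\<in>X. Q n x}) \<noteq> {}" by blast
  qed
  then show ?thesis by blast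
qed

lemma finite_words:
  fixes X :: "(int \<Rightarrow> 'a::discrete_topology) set"
  assumes "shift_space X"
  obtains A where "finite A" "language X \<subseteq> lists A"
proof -
  obtain A where A: "finite A" "\<forall>x\<in>X. range x \<subseteq> A"
    using assms by (auto simp: shift_space_def)
  have "w \<in> lists A" if w: "w \<in> language X" for w
  proof -
    obtain x i where "x \<in> X" "occurs_at w x i" using w by (auto simp: language_def)
    then have "x \<in> X" "window x i (length w) = w" by (simp_all add: occurs_at_iff_window)
    then have "set w \<subseteq> range x" by (metis window_def list.set_map image_mono subset_UNIV image_image image_subset_iff rangeI)
    then show ?thesis using A \<open>x \<in> X\<close> by auto
  qed
  then show ?thesis using that A by blast
qed

text \<open>
  Allowing two different positions \<open>j\<close> and \<open>j'\<close> builds shift invariance into the notion, so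
  that equal windows anywhere in two points have equal images.
\<close>
definition block_radius :: "(int \<Rightarrow> 'a) set \<Rightarrow> ((int \<Rightarrow> 'a) \<Rightarrow> int \<Rightarrow> 'b) \<Rightarrow> nat \<Rightarrow> bool" where
  "block_radius X \<pi> r \<longleftrightarrow>
     (\<forall>x\<in>X. \<forall>x'\<in>X. \<forall>j j'. (\<forall>k\<in>{- int r..int r}. x (j + k) = x' (j' + k)) \<longrightarrow> \<pi> x j = \<pi> x' j')"

lemma factor_code_translate:
  assumes "factor_code X Y \<pi>" "x \<in> X"
  shows "\<pi> (translate t x) = translate t (\<pi> x)"
proof -
  have X: "shift_space X" and sh: "\<And>x. x \<in> X \<Longrightarrow> \<pi> (translate 1 x) = translate 1 (\<pi> x)"
    using assms(1) by (auto simp: factor_code_def shift_eq_translate)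
  have tr: "\<And>t x. x \<in> X \<Longrightarrow> translate t x \<in> X" by (rule shift_space_translate_in[OF X])
  have fwd: "\<pi> (translate (int n) x) = translate (int n) (\<pi> x)" if "x \<in> X" for x n
  proof (induction n)
    case (Suc n)
    then show ?case using sh[OF tr[OF that, of "int n"]] by simp
  qed simp
  show ?thesis
  proof (cases "t \<ge> 0")
    case True then show ?thesis using fwd[OF assms(2), of "nat t"] by simp
  next
    case False
    have "\<pi> x = translate (- t) (\<pi> (translate t x))"
      using fwd[OF tr[OF assms(2), of t], of "nat (- t)"] False by simp
    then show ?thesis by simp
  qed
qed

text \<open>
  The Curtis--Hedlund--Lyndon theorem: continuity gives each point \<open>x\<close> a window that determines
  \<open>\<pi> x 0\<close>, and by compactness finitely many of these windows suffice; \<open>r\<close> is the largest.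
\<close>
theorem factor_code_block_radius:
  fixes X :: "(int \<Rightarrow> 'a::discrete_topology) set" and Y :: "(int \<Rightarrow> 'b::discrete_topology) set"
  assumes \<pi>: "factor_code X Y \<pi>"
  obtains r where "block_radius X \<pi> r"
proof -
  have X: "shift_space X" and cont: "continuous_on X \<pi>" using \<pi> by (auto simp: factor_code_def)
  have "\<exists>n::nat. \<forall>z\<in>X. (\<forall>i\<in>{- int n..int n}. z i = x i) \<longrightarrow> \<pi> z 0 = \<pi> x 0" if "x \<in> X" for x
  proof -
    have "open {y. y (0::int) = \<pi> x 0}" using open_cylinder[of "{0}" "\<pi> x"] by simp
    then obtain U where U: "open U" "U \<inter> X = \<pi> -` {y. y 0 = \<pi> x 0} \<inter> X"
      using cont unfolding continuous_on_open_invariant by blast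
    then have "x \<in> U" using that by blast
    then obtain n :: nat where "\<And>z. (\<forall>i\<in>{- int n..int n}. z i = x i) \<Longrightarrow> z \<in> U"
      using open_contains_cylinder[OF U(1)] by metis
    then show ?thesis using U(2) by blast
  qed
  then obtain N :: "(int \<Rightarrow> 'a) \<Rightarrow> nat" where
    N: "\<And>x z. x \<in> X \<Longrightarrow> z \<in> X \<Longrightarrow> (\<forall>i\<in>{- int (N x)..int (N x)}. z i = x i) \<Longrightarrow> \<pi> z 0 = \<pi> x 0"
    by metis
  obtain F where F: "F \<subseteq> X" "finite F" "X \<subseteq> (\<Union>x\<in>F. {z. \<forall>i\<in>{- int (N x)..int (N x)}. z i = x i})"
    by (rule compactE_image[OF compact_shift_space[OF X],
          of X "\<lambda>x. {z. \<forall>i\<in>{- int (N x)..int (N x)}. z i = x i}"])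
       (auto intro!: open_cylinder)
  define r where "r = Max (insert 0 (N ` F))"
  have r: "N x \<le> r" if "x \<in> F" for x unfolding r_def using F that by (intro Max_ge) auto
  have *: "\<pi> x 0 = \<pi> x' 0" if x: "x \<in> X" "x' \<in> X" and a: "\<forall>k\<in>{- int r..int r}. x k = x' k" for x x'
  proof -
    obtain c where c: "c \<in> F" "\<forall>i\<in>{- int (N c)..int (N c)}. x i = c i" using F(3) x(1) by blast
    then have "\<forall>i\<in>{- int (N c)..int (N c)}. x' i = c i" using r[OF c(1)] a by force
    then show ?thesis using N[of c] c F(1) x by (metis subsetD)
  qed
  have "block_radius X \<pi> r"
    unfolding block_radius_def
  proof (intro ballI allI impI)
    fix x x' j j' assume x: "x \<in> X" "x' \<in> X" and a: "\<forall>k\<in>{- int r..int r}. x (j + k) = x' (j' + k)"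
    have "\<pi> (translate j x) 0 = \<pi> (translate j' x') 0"
      using a x by (intro *) (auto simp: add.commute translate_apply intro: shift_space_translate_in[OF X])
    then show "\<pi> x j = \<pi> x' j'"
      using x by (simp add: factor_code_translate[OF \<pi>] translate_apply)
  qed
  then show ?thesis using that by blast
qed

lemma block_radiusD:
  assumes "block_radius X \<pi> r" "x \<in> X" "x' \<in> X" "\<And>k. j - int r \<le> k \<Longrightarrow> k \<le> j + int r \<Longrightarrow> x k = x' k"
  shows "\<pi> x j = \<pi> x' j"
  using assms unfolding block_radius_def by force

lemma block_radius_window:
  assumes "block_radius X \<pi> r" "x \<in> X" "x' \<in> X"
    and "window x i (n + 2 * r) = window x' i' (n + 2 * r)"
  shows "window (\<pi> x) (i + int r) n = window (\<pi> x') (i' + int r) n"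
proof -
  have a: "x (i + k) = x' (i' + k)" if "0 \<le> k" "k < int (n + 2 * r)" for k
    using assms(4) that unfolding window_eq_iff by auto
  have "\<pi> x (i + int r + k) = \<pi> x' (i' + int r + k)" if k: "k \<in> {0..<int n}" for k
  proof -
    have "\<forall>l\<in>{- int r..int r}. x (i + int r + k + l) = x' (i' + int r + k + l)"
      using a[of "int r + k + _"] k by (auto simp: add.assoc)
    then show ?thesis using assms(1-3) unfolding block_radius_def by blast
  qed
  then show ?thesis by (simp add: window_eq_iff)
qed

section \<open>Regularity of the language and synchronizing words\<close>

definition splice_at :: "int \<Rightarrow> (int \<Rightarrow> 'a) \<Rightarrow> (int \<Rightarrow> 'a) \<Rightarrow> int \<Rightarrow> 'a" where
  "splice_at i x x' = (\<lambda>k. if k < i then x k else x' k)"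

lemma occurs_at_agree:
  assumes "\<And>k. i \<le> k \<Longrightarrow> k < i + int (length w) \<Longrightarrow> x k = z k"
  shows "occurs_at w x i \<longleftrightarrow> occurs_at w z i"
proof -
  have "window x i (length w) = window z i (length w)"
    using assms by (simp add: window_eq_same_iff)
  then show ?thesis by (simp add: occurs_at_iff_window)
qed

lemma occurs_at_both_agree:
  assumes "occurs_at w x i" "occurs_at w z i" "i \<le> k" "k < i + int (length w)"
  shows "x k = z k"
proof -
  have "window x i (length w) = window z i (length w)"
    using assms by (simp add: occurs_at_iff_window)
  then show ?thesis using assms(3,4) by (simp add: window_eq_same_iff)
qed

text \<open>
  If the two points agree on a word at the junction, the spliced point follows the left one up to
  the end of that word, not only up to its beginning.
\<close>
lemma splice_at_left:
  assumes "occurs_at s x i" "occurs_at s x' i" "k < i + int (length s)"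
  shows "splice_at i x x' k = x k"
  using occurs_at_both_agree[OF assms(1,2), of k] assms(3) by (auto simp: splice_at_def)

lemma splice_at_right: "i \<le> k \<Longrightarrow> splice_at i x x' k = x' k"
  by (simp add: splice_at_def)

text \<open>
  Let \<open>X\<close> be the image of a shift of finite type \<open>Z\<close>, and let \<open>K\<close> bound both the memory of \<open>Z\<close> and
  the radius of the factor code. The \<open>2K\<close>-block of a point of \<open>Z\<close> around the origin serves as a
  state: \<open>S u\<close> collects the states that can follow \<open>u\<close>, and \<open>P w\<close> those that can precede \<open>w\<close>. A common
  state allows the two points of \<open>Z\<close> to be spliced at the origin.
\<close>
lemma sofic_language_regular:
  fixes X :: "(int \<Rightarrow> 'a::discrete_topology) set"
  assumes "sofic X"
  obtains S P :: "'a list \<Rightarrow> nat list set" where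
    "finite (range S)" "finite (range P)"
    "\<And>u w. u @ w \<in> language X \<longleftrightarrow> S u \<inter> P w \<noteq> {}"
proof -
  obtain Z :: "(int \<Rightarrow> nat) set" and \<phi> where
    sft: "shift_of_finite_type Z" and \<phi>: "factor_code Z X \<phi>"
    using assms by (auto simp: sofic_def)
  obtain A F where A: "finite A" and F: "finite F"
    and Z: "Z = {x. range x \<subseteq> A \<and> (\<forall>w\<in>F. \<forall>i. \<not> occurs_at w x i)}"
    using sft by (auto simp: shift_of_finite_type_def)
  have ssX: "shift_space X" and surj: "\<phi> ` Z = X" and ssZ: "shift_space Z"
    using \<phi> by (auto simp: factor_code_def)
  obtain r where r: "block_radius Z \<phi> r" using factor_code_block_radius[OF \<phi>] .
  define K where "K = Max (insert r (length ` F))"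
  have K: "r \<le> K" "\<And>w. w \<in> F \<Longrightarrow> length w \<le> K"
    unfolding K_def using F by (auto intro: Max_ge)
  define S where "S u = {window z (- int K) (2 * K) | z. z \<in> Z \<and> occurs_at u (\<phi> z) (- int (length u))}"
    for u
  define P where "P w = {window z (- int K) (2 * K) | z. z \<in> Z \<and> occurs_at w (\<phi> z) 0}" for w
  let ?B = "{l. set l \<subseteq> A \<and> length l = 2 * K}"
  have "window z i n \<in> lists A" if "z \<in> Z" for z i n
    using that unfolding Z by (auto simp: window_def image_subset_iff)
  then have sub: "S u \<in> Pow ?B" "P u \<in> Pow ?B" for u
    unfolding S_def P_def by (force simp: in_lists_conv_set)+
  have "finite ?B" by (rule finite_lists_length_eq[OF A])
  then have "finite (Pow ?B)" by simp
  then have fin: "finite (range S)" "finite (range P)"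
    using sub by (metis (no_types, lifting) finite_subset image_subsetI)+
  have iff: "u @ w \<in> language X \<longleftrightarrow> S u \<inter> P w \<noteq> {}" for u w
  proof
    assume "u @ w \<in> language X"
    then obtain x where x: "x \<in> X" "occurs_at (u @ w) x (- int (length u))"
      using language_at[OF ssX] by metis
    then obtain z where z: "z \<in> Z" "x = \<phi> z" using surj by blast
    then have "window z (- int K) (2 * K) \<in> S u \<inter> P w"
      using x(2) unfolding S_def P_def by (auto simp: occurs_at_append)
    then show "S u \<inter> P w \<noteq> {}" by blast
  next
    assume "S u \<inter> P w \<noteq> {}"
    then obtain z z' where z: "z \<in> Z" "occurs_at u (\<phi> z) (- int (length u))"
      and z': "z' \<in> Z" "occurs_at w (\<phi> z') 0"
      and eq: "window z (- int K) (2 * K) = window z' (- int K) (2 * K)"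
      unfolding S_def P_def by (smt (verit) disjoint_iff mem_Collect_eq)
    define t where "t = splice_at 0 z z'"
    have tz: "t k = z k" if "k < int K" for k
      using that eq by (auto simp: t_def splice_at_def window_eq_same_iff)
    have tz': "t k = z' k" if "- int K \<le> k" for k
      using that eq by (auto simp: t_def splice_at_def window_eq_same_iff)
    have "t \<in> Z"
      unfolding Z
    proof (intro CollectI conjI ballI allI notI)
      show "range t \<subseteq> A" using z(1) z'(1) by (auto simp: Z t_def splice_at_def)
      fix v i assume v: "v \<in> F" and oc: "occurs_at v t i"
      show False
      proof (cases "i + int (length v) \<le> int K")
        case True
        then have "occurs_at v z i" using oc occurs_at_agree[of i v t z] tz by auto
        then show False using z(1) v by (auto simp: Z)
      next
        case False
        then have "occurs_at v z' i" using oc occurs_at_agree[of i v t z'] tz' K(2)[OF v] by auto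
        then show False using z'(1) v by (auto simp: Z)
      qed
    qed
    have "\<phi> t k = \<phi> z k" if "k < 0" for k
      using K(1) that by (intro block_radiusD[OF r \<open>t \<in> Z\<close> z(1)] tz) auto
    then have "occurs_at u (\<phi> t) (- int (length u))"
      using z(2) occurs_at_agree[of "- int (length u)" u "\<phi> t" "\<phi> z"] by auto
    moreover have "\<phi> t k = \<phi> z' k" if "0 \<le> k" for k
      using K(1) that by (intro block_radiusD[OF r \<open>t \<in> Z\<close> z'(1)] tz') auto
    then have "occurs_at w (\<phi> t) 0"
      using z'(2) occurs_at_agree[of 0 w "\<phi> t" "\<phi> z'"] by auto
    ultimately have "occurs_at (u @ w) (\<phi> t) (- int (length u))" by (simp add: occurs_at_append)
    moreover have "\<phi> t \<in> X" using surj \<open>t \<in> Z\<close> by blast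
    ultimately show "u @ w \<in> language X" by (auto simp: language_def)
  qed
  show ?thesis using that fin iff by blast
qed

definition follower_set :: "'a list set \<Rightarrow> 'a list \<Rightarrow> 'a list set" where
  "follower_set L u = {v. u @ v \<in> L}"

definition predecessor_set :: "'a list set \<Rightarrow> 'a list \<Rightarrow> 'a list set" where
  "predecessor_set L w = {v. v @ w \<in> L}"

lemma sofic_finite_follower_sets:
  fixes X :: "(int \<Rightarrow> 'a::discrete_topology) set"
  assumes "sofic X"
  shows "finite (range (follower_set (language X)))" "finite (range (predecessor_set (language X)))"
proof -
  obtain S P :: "'a list \<Rightarrow> nat list set" where SP: "finite (range S)" "finite (range P)"
    "\<And>u w. u @ w \<in> language X \<longleftrightarrow> S u \<inter> P w \<noteq> {}"
    using sofic_language_regular[OF assms] by blast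
  have "range (follower_set (language X)) \<subseteq> (\<lambda>E. {v. E \<inter> P v \<noteq> {}}) ` range S"
    by (auto simp: follower_set_def SP(3))
  then show "finite (range (follower_set (language X)))" using SP(1) finite_surj by blast
  have "range (predecessor_set (language X)) \<subseteq> (\<lambda>E. {v. S v \<inter> E \<noteq> {}}) ` range P"
    by (auto simp: predecessor_set_def SP(3))
  then show "finite (range (predecessor_set (language X)))" using SP(2) finite_surj by blast
qed

text \<open>
  Whether \<open>q\<close> connects \<open>u\<close> to \<open>w\<close> depends only on the follower set of \<open>u\<close> and the predecessor set of
  \<open>w\<close>. There are finitely many such pairs, so one bridge for each of them gives a uniform bound.
\<close>
lemma bounded_bridges:
  fixes X :: "(int \<Rightarrow> 'a::discrete_topology) set"
  assumes "sofic X" "irreducible_shift X" "s \<in> language X"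
  obtains C where "\<And>u w. u \<in> language X \<Longrightarrow> w \<in> language X \<Longrightarrow>
    \<exists>q. length q \<le> C \<and> sublist s q \<and> u @ q @ w \<in> language X"
proof -
  let ?L = "language X"
  define key where "key = (\<lambda>(u, w). (follower_set ?L u, predecessor_set ?L w))"
  have "range key \<subseteq> range (follower_set ?L) \<times> range (predecessor_set ?L)"
    unfolding key_def by auto
  then have "finite (range key)"
    using sofic_finite_follower_sets[OF assms(1)] by (meson finite_SigmaI finite_subset)
  then have fin: "finite (key ` (?L \<times> ?L))" by (meson finite_subset image_mono subset_UNIV)
  have same: "u @ q @ w \<in> ?L" if "key (u, w) = key (u', w')" "u' @ q @ w' \<in> ?L" for u w u' w' q
  proof -
    have "q @ w' \<in> follower_set ?L u" using that by (simp add: key_def follower_set_def)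
    then have "u @ q \<in> predecessor_set ?L w'" by (simp add: follower_set_def predecessor_set_def)
    then have "u @ q \<in> predecessor_set ?L w" using that by (simp add: key_def)
    then show ?thesis by (simp add: predecessor_set_def)
  qed
  have ex: "\<exists>q. sublist s q \<and> u @ q @ w \<in> ?L" if u: "u \<in> ?L" and w: "w \<in> ?L" for u w
  proof -
    obtain a where a: "u @ a @ s \<in> ?L"
      using assms(2,3) u unfolding irreducible_shift_def by blast
    obtain b where "(u @ a @ s) @ b @ w \<in> ?L"
      using assms(2) a w unfolding irreducible_shift_def by blast
    then have "sublist s (a @ s @ b) \<and> u @ (a @ s @ b) @ w \<in> ?L" by simp
    then show ?thesis by blast
  qed
  have "\<forall>p\<in>key ` (?L \<times> ?L). \<exists>q. sublist s q \<and> (\<forall>u w. key (u, w) = p \<longrightarrow> u @ q @ w \<in> ?L)"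
  proof (rule ballI)
    fix p assume "p \<in> key ` (?L \<times> ?L)"
    then obtain u' w' where "p = key (u', w')" "u' \<in> ?L" "w' \<in> ?L" by blast
    then show "\<exists>q. sublist s q \<and> (\<forall>u w. key (u, w) = p \<longrightarrow> u @ q @ w \<in> ?L)"
      using ex[of u' w'] same by metis
  qed
  then obtain Q where Q: "\<And>u w. u \<in> ?L \<Longrightarrow> w \<in> ?L \<Longrightarrow>
      sublist s (Q (key (u, w))) \<and> u @ Q (key (u, w)) @ w \<in> ?L"
    by (metis (no_types, lifting) SigmaI image_eqI)
  define C where "C = Max (insert 0 ((\<lambda>p. length (Q p)) ` key ` (?L \<times> ?L)))"
  have "length (Q (key (u, w))) \<le> C" if "u \<in> ?L" "w \<in> ?L" for u w
    unfolding C_def using fin that by (intro Max_ge) auto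
  then show ?thesis using that[of C] Q by metis
qed

text \<open>
  Past and future are independent once such a word has been seen; these words are also known as
  intrinsically synchronizing or magic words.
\<close>
definition synchronizing :: "(int \<Rightarrow> 'a) set \<Rightarrow> 'a list \<Rightarrow> bool" where
  "synchronizing X s \<longleftrightarrow> s \<in> language X \<and>
     (\<forall>u v. u @ s \<in> language X \<longrightarrow> s @ v \<in> language X \<longrightarrow> u @ s @ v \<in> language X)"

lemma synchronizing_extend:
  assumes "synchronizing X s" "a @ s @ b \<in> language X"
  shows "synchronizing X (a @ s @ b)"
  unfolding synchronizing_def
proof (intro conjI allI impI)
  fix u v assume "u @ a @ s @ b \<in> language X" "(a @ s @ b) @ v \<in> language X"
  then have "(u @ a) @ s \<in> language X" "s @ (b @ v) \<in> language X"
    using language_appendD[of "u @ a @ s" b X] language_appendD[of a "s @ b @ v" X] by simp_all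
  then show "u @ (a @ s @ b) @ v \<in> language X"
    using assms(1) unfolding synchronizing_def by (metis append.assoc)
qed (rule assms(2))

text \<open>
  Take \<open>w\<close> with the fewest follower sets of words ending in \<open>w\<close>. If \<open>u w\<close> and \<open>w v\<close> were words but
  \<open>u w v\<close> were not, then passing from \<open>w\<close> to \<open>w v\<close> would kill the follower set of \<open>u w\<close> and create
  no new ones, against minimality.
\<close>
lemma exists_synchronizing:
  assumes fin: "finite (range (follower_set (language X)))" and ne: "language X \<noteq> {}"
  shows "\<exists>s. synchronizing X s"
proof -
  let ?L = "language X"
  define \<F> where "\<F> w = {follower_set ?L (u @ w) | u. u @ w \<in> ?L}" for w
  have finF: "finite (\<F> w)" for w
    unfolding \<F>_def by (rule finite_subset[OF _ fin]) auto
  obtain w where w: "w \<in> ?L" "\<And>w'. w' \<in> ?L \<Longrightarrow> card (\<F> w) \<le> card (\<F> w')"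
    using ne ex_has_least_nat[of "\<lambda>w. w \<in> ?L" _ "\<lambda>w. card (\<F> w)"] by blast
  have "u @ w @ v \<in> ?L" if uw: "u @ w \<in> ?L" and wv: "w @ v \<in> ?L" for u v
  proof (rule ccontr)
    assume no: "u @ w @ v \<notin> ?L"
    have E: "follower_set ?L (u @ w) \<in> \<F> w" using uw by (auto simp: \<F>_def)
    have "\<F> (w @ v) \<subseteq> (\<lambda>E. {t. v @ t \<in> E}) ` (\<F> w - {follower_set ?L (u @ w)})"
    proof
      fix E assume "E \<in> \<F> (w @ v)"
      then obtain u' where u': "u' @ w @ v \<in> ?L" "E = follower_set ?L (u' @ w @ v)"
        by (auto simp: \<F>_def)
      then have "u' @ w \<in> ?L" using language_appendD[of "u' @ w" v X] by simp
      then have "follower_set ?L (u' @ w) \<in> \<F> w" by (auto simp: \<F>_def)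
      moreover have "follower_set ?L (u' @ w) \<noteq> follower_set ?L (u @ w)"
        using u'(1) no by (auto simp: follower_set_def)
      moreover have "E = {t. v @ t \<in> follower_set ?L (u' @ w)}"
        by (simp add: u'(2) follower_set_def)
      ultimately show "E \<in> (\<lambda>E. {t. v @ t \<in> E}) ` (\<F> w - {follower_set ?L (u @ w)})" by blast
    qed
    then have "card (\<F> (w @ v)) \<le> card (\<F> w - {follower_set ?L (u @ w)})"
      using finF by (meson surj_card_le finite_Diff)
    also have "\<dots> < card (\<F> w)" using E finF by (intro psubset_card_mono) auto
    finally show False using w(2)[OF wv] by simp
  qed
  then show ?thesis using w(1) unfolding synchronizing_def by blast
qed

lemma exists_long_synchronizing:
  fixes X :: "(int \<Rightarrow> 'a::discrete_topology) set"
  assumes "sofic X" "X \<noteq> {}"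
  obtains s where "synchronizing X s" "n \<le> length s"
proof -
  have "language X \<noteq> {}" using assms(2) window_in_language by (metis all_not_in_conv)
  then obtain s where s: "synchronizing X s"
    using exists_synchronizing sofic_finite_follower_sets(1)[OF assms(1)] by blast
  then obtain x i where x: "x \<in> X" "occurs_at s x i"
    by (auto simp: synchronizing_def language_def)
  then have "window x i (length s + n) = [] @ s @ window x (i + int (length s)) n"
    by (simp add: window_add occurs_at_iff_window)
  then have "synchronizing X ([] @ s @ window x (i + int (length s)) n)"
    using s x(1) by (metis synchronizing_extend window_in_language)
  then show ?thesis using that by force
qed

text \<open>
  Splicing is possible at a synchronizing word because any window of the result consists of a past
  of \<open>s\<close> taken from \<open>x\<close>, the word \<open>s\<close>, and a future of \<open>s\<close> taken from \<open>x'\<close>.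
\<close>
lemma splice_at_in:
  fixes X :: "(int \<Rightarrow> 'a::discrete_topology) set"
  assumes X: "shift_space X" and s: "synchronizing X s" and x: "x \<in> X" "x' \<in> X"
    and oc: "occurs_at s x i" "occurs_at s x' i"
  shows "splice_at i x x' \<in> X"
proof (rule in_shift_space_if_windows[OF X])
  fix i0 :: int and n :: nat
  define a where "a = nat (i - i0)"
  define b where "b = nat (i0 + int n - i)"
  let ?z = "splice_at i x x'" and ?j = "i - int a"
  have u: "window ?z ?j a = window x ?j a"
    by (simp add: window_eq_same_iff splice_at_def)
  have s1: "window ?z i (length s) = s" and s2: "window x i (length s) = s"
    and s3: "window x' i (length s) = s"
    using oc by (simp_all add: occurs_at_iff_window splice_at_def window_def)
  have v: "window ?z (i + int (length s)) b = window x' (i + int (length s)) b"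
    by (simp add: window_eq_same_iff splice_at_def)
  have "window x ?j (a + length s) \<in> language X" "window x' i (length s + b) \<in> language X"
    using x by (simp_all add: window_in_language)
  then have "window x ?j a @ s \<in> language X" "s @ window x' (i + int (length s)) b \<in> language X"
    by (simp_all add: window_add s2 s3)
  then have "window x ?j a @ s @ window x' (i + int (length s)) b \<in> language X"
    using s by (simp add: synchronizing_def)
  then have "window ?z ?j (a + (length s + b)) \<in> language X"
    by (simp add: window_add u s1 v)
  moreover have "?j \<le> i0" "i0 + int n \<le> ?j + int (a + (length s + b))"
    by (auto simp: a_def b_def)
  ultimately show "\<exists>j m. j \<le> i0 \<and> i0 + int n \<le> j + int m \<and> window ?z j m \<in> language X" by blast
qed

section \<open>Words of the factor that force synchronization\<close>

text \<open>
  The bound \<open>2 * r < length s\<close> makes every interval of length \<open>2 * r + 1\<close> lie on one side of a splice,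
  so that splicing two points along \<open>s\<close> also splices their images.
\<close>
locale synchronized_code =
  fixes X :: "(int \<Rightarrow> 'a::discrete_topology) set" and Y :: "(int \<Rightarrow> 'b::discrete_topology) set"
    and \<pi> :: "(int \<Rightarrow> 'a) \<Rightarrow> int \<Rightarrow> 'b" and r :: nat and s :: "'a list"
  assumes sofic: "sofic X" and irreducible: "irreducible_shift X" and code: "factor_code X Y \<pi>"
    and finite_fibers: "finite_to_one X Y \<pi>" and radius: "block_radius X \<pi> r"
    and sync: "synchronizing X s" and long: "2 * r < length s"
begin

lemma X: "shift_space X" and Y: "shift_space Y" and surj: "\<pi> ` X = Y"
  using code by (auto simp: factor_code_def)

lemma splice_image:
  assumes "x \<in> X" "x' \<in> X" "occurs_at s x i" "occurs_at s x' i"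
  shows "k < i + int (length s) - int r \<Longrightarrow> \<pi> (splice_at i x x') k = \<pi> x k"
    and "i + int r \<le> k \<Longrightarrow> \<pi> (splice_at i x x') k = \<pi> x' k"
proof -
  note z = splice_at_in[OF X sync assms]
  show "k < i + int (length s) - int r \<Longrightarrow> \<pi> (splice_at i x x') k = \<pi> x k"
    using assms by (intro block_radiusD[OF radius z] splice_at_left[of s]) auto
  show "i + int r \<le> k \<Longrightarrow> \<pi> (splice_at i x x') k = \<pi> x' k"
    using assms by (intro block_radiusD[OF radius z] splice_at_right) auto
qed

text \<open>
  Two different words \<open>W\<close>, \<open>W'\<close> that start and end with \<open>s\<close> cannot have the same image. By
  irreducibility there is a periodic point repeating \<open>W c\<close>, and exchanging any one of its copies of
  \<open>W\<close> for \<open>W'\<close> does not change its image; so its image would have infinitely many preimages.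
\<close>
lemma no_diamond:
  assumes x: "x \<in> X" and x': "x' \<in> X"
    and s0: "occurs_at s x 0" "occurs_at s x' 0" and sn: "occurs_at s x (int n)" "occurs_at s x' (int n)"
    and im: "\<And>k. int r \<le> k \<Longrightarrow> k < int n + int (length s) - int r \<Longrightarrow> \<pi> x k = \<pi> x' k"
    and k: "0 \<le> k" "k < int n + int (length s)"
  shows "x k = x' k"
proof (rule ccontr)
  assume ne: "x k \<noteq> x' k"
  let ?L = "language X"
  define W where "W = window x 0 (n + length s)"
  have W_L: "W \<in> ?L" unfolding W_def by (rule window_in_language[OF x])
  obtain \<alpha> where \<alpha>: "W = \<alpha> @ s"
    using sn(1) by (auto simp: W_def window_add occurs_at_iff_window)
  obtain c where c: "W @ c @ W \<in> ?L"
    using irreducible W_L unfolding irreducible_shift_def by blast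
  define p where "p = length (W @ c)"
  have p: "n + length s \<le> p" "0 < p" using long by (auto simp: p_def W_def)
  have rep: "concat (replicate m (W @ c)) @ W \<in> ?L" for m
  proof (induction m)
    case 0 then show ?case by (simp add: W_L)
  next
    case (Suc m)
    have "s @ c @ W \<in> ?L" using c language_appendD(2)[of \<alpha> "s @ c @ W" X] by (simp add: \<alpha>)
    moreover have "(concat (replicate m (W @ c)) @ \<alpha>) @ s \<in> ?L" using Suc by (simp add: \<alpha>)
    ultimately have "(concat (replicate m (W @ c)) @ \<alpha>) @ s @ c @ W \<in> ?L"
      using sync unfolding synchronizing_def by blast
    moreover have "concat (replicate (Suc m) (W @ c)) = concat (replicate m (W @ c)) @ W @ c"
      by (metis append_Nil2 concat.simps concat_append replicate_Suc replicate_append_same)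
    ultimately show ?case by (simp add: \<alpha>)
  qed
  define per where "per i = (W @ c) ! nat (i mod int p)" for i
  have per_p: "window per (j * int p) p = W @ c" for j
    by (rule nth_equalityI) (simp_all add: per_def p_def del: length_append)
  have per_rep: "window per (j * int p) (m * p) = concat (replicate m (W @ c))" for j m
  proof (induction m arbitrary: j)
    case (Suc m)
    have "window per (j * int p) (Suc m * p) = window per (j * int p) p @ window per ((j + 1) * int p) (m * p)"
      by (simp add: window_add algebra_simps)
    then show ?case using Suc by (simp add: per_p)
  qed simp
  have per_X: "per \<in> X"
  proof (rule in_shift_space_if_windows[OF X])
    fix i :: int and l :: nat
    define m where "m = nat \<bar>i\<bar> + l"
    have p1: "int m \<le> int m * int p" using p(2) mult_left_mono[of 1 "int p" "int m"] by simp
    have "window per (- int m * int p) ((2 * m) * p) \<in> ?L"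
      using language_appendD(1)[OF rep[of "2 * m"]] by (simp only: per_rep)
    moreover have "- int m * int p \<le> i" "i + int l \<le> - int m * int p + int ((2 * m) * p)"
    proof -
      have "- int m \<le> i" "i + int l \<le> int m" by (auto simp: m_def)
      then show "- int m * int p \<le> i" "i + int l \<le> - int m * int p + int ((2 * m) * p)"
        using p1 by simp_all
    qed
    ultimately show "\<exists>j m. j \<le> i \<and> i + int l \<le> j + int m \<and> window per j m \<in> ?L" by blast
  qed
  have per_x: "per (j * int p + k) = x k" if "0 \<le> k" "k < int n + int (length s)" for j k
  proof -
    have "window per (j * int p) p ! nat k = (W @ c) ! nat k" by (simp add: per_p)
    moreover have "nat k < length W" "nat k < p" using that p(1) by (auto simp: W_def)
    ultimately show ?thesis using that by (simp add: nth_append W_def)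
  qed
  define x1 where "x1 j = translate (- j * int p) x" for j
  define x2 where "x2 j = translate (- j * int p) x'" for j
  have x1_per: "x1 j i = per i" if "j * int p \<le> i" "i < j * int p + int n + int (length s)" for i j
    using per_x[of "i - j * int p" j] that by (simp add: x1_def translate_apply)
  have in2: "x1 j \<in> X" "x2 j \<in> X" for j using x x' by (auto simp: x1_def x2_def intro: shift_space_translate_in[OF X])
  have oc: "occurs_at s (x1 j) (j * int p)" "occurs_at s (x2 j) (j * int p)"
     "occurs_at s (x1 j) (j * int p + int n)" "occurs_at s (x2 j) (j * int p + int n)" for j
    using s0 sn by (simp_all add: x1_def x2_def occurs_at_translate)
  have ocp: "occurs_at s per (j * int p)" "occurs_at s per (j * int p + int n)" for j
    using oc(1,3)[of j] occurs_at_agree[of _ s "x1 j" per] x1_per[of j] by auto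
  \<comment> \<open>\<open>y j\<close> is the periodic point with its copy of \<open>W\<close> at \<open>j * p\<close> exchanged for the word of \<open>x'\<close>;
      \<open>y1 j\<close> is the right half of this double splice.\<close>
  define y1 where "y1 j = splice_at (j * int p + int n) (x2 j) per" for j
  define y where "y j = splice_at (j * int p) per (y1 j)" for j
  have y1_X: "y1 j \<in> X" for j
    unfolding y1_def by (rule splice_at_in[OF X sync in2(2) per_X oc(4) ocp(2)])
  have oc1: "occurs_at s (y1 j) (j * int p)" for j
    using oc(2)[of j] occurs_at_agree[of "j * int p" s "x2 j" "y1 j"]
      splice_at_left[OF oc(4) ocp(2), of _ j] by (auto simp: y1_def)
  have y_X: "y j \<in> X" for j
    unfolding y_def by (rule splice_at_in[OF X sync per_X y1_X ocp(1) oc1])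
  have "\<pi> (y j) = \<pi> per" for j
  proof
    fix i
    have im': "\<pi> (x2 j) i = \<pi> per i" if "j * int p + int r \<le> i" "i < j * int p + int n + int (length s) - int r"
    proof -
      have "\<pi> (x2 j) i = \<pi> (x1 j) i"
        using im[of "i - j * int p"] that x x'
        by (simp add: x1_def x2_def factor_code_translate[OF code] translate_apply)
      also have "\<dots> = \<pi> per i"
        using that by (intro block_radiusD[OF radius in2(1) per_X] x1_per) auto
      finally show ?thesis .
    qed
    consider "i < j * int p + int (length s) - int r"
      | "j * int p + int r \<le> i" "i < j * int p + int n + int (length s) - int r"
      | "j * int p + int n + int r \<le> i" "j * int p + int r \<le> i"
      using long by linarith
    then show "\<pi> (y j) i = \<pi> per i"
    proof cases
      case 1
      then show ?thesis unfolding y_def using splice_image(1)[OF per_X y1_X ocp(1) oc1] by simp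
    next
      case 2
      then have "\<pi> (y j) i = \<pi> (y1 j) i" unfolding y_def by (intro splice_image(2)[OF per_X y1_X ocp(1) oc1])
      also have "\<dots> = \<pi> (x2 j) i"
        unfolding y1_def using 2 by (intro splice_image(1)[OF in2(2) per_X oc(4) ocp(2)])
      finally show ?thesis using im' 2 by simp
    next
      case 3
      then have "\<pi> (y j) i = \<pi> (y1 j) i" unfolding y_def by (intro splice_image(2)[OF per_X y1_X ocp(1) oc1])
      also have "\<dots> = \<pi> per i"
        unfolding y1_def using 3 by (intro splice_image(2)[OF in2(2) per_X oc(4) ocp(2)])
      finally show ?thesis .
    qed
  qed
  then have "range y \<subseteq> fiber X \<pi> (\<pi> per)" using y_X by (auto simp: fiber_def)
  moreover have "finite (fiber X \<pi> (\<pi> per))"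
    using finite_fibers per_X surj by (auto simp: finite_to_one_def)
  ultimately have "finite (range y)" by (rule finite_subset)
  moreover have "inj y"
  proof (rule injI)
    fix i j assume eq: "y i = y j"
    show "i = j"
    proof (rule ccontr)
      assume "i \<noteq> j"
      let ?k = "i * int p + k"
      have "y1 i ?k = x2 i ?k"
        unfolding y1_def using k by (intro splice_at_left[OF oc(4) ocp(2)]) auto
      then have "y i ?k = x' k" using k by (simp add: y_def splice_at_def x2_def translate_apply)
      moreover have "y j ?k = per ?k"
      proof (cases "i < j")
        case True
        then have "(i + 1) * int p \<le> j * int p" by (intro mult_right_mono) auto
        then have "?k < j * int p" using k p(1) by (simp add: algebra_simps)
        then show ?thesis by (simp add: y_def splice_at_def)
      next
        case False
        then have "(j + 1) * int p \<le> i * int p" using \<open>i \<noteq> j\<close> by (intro mult_right_mono) auto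
        then have "j * int p + int n \<le> ?k" using k p(1) by (simp add: algebra_simps)
        then show ?thesis by (simp add: y_def y1_def splice_at_def)
      qed
      ultimately show False using eq ne per_x[OF k] by metis
    qed
  qed
  ultimately show False using finite_imageD[of y UNIV] infinite_UNIV_int by blast
qed

end

lemma finite_words_of_length:
  fixes Z :: "(int \<Rightarrow> 'c::discrete_topology) set"
  assumes "shift_space Z"
  shows "finite {w \<in> language Z. length w = n}"
proof -
  obtain A where "finite A" "language Z \<subseteq> lists A" using finite_words[OF assms] .
  then show ?thesis
    by (intro finite_subset[OF _ finite_lists_length_eq[of A n]]) auto
qed

lemma sublist_windowE:
  assumes "sublist s (window x i n)"
  obtains k where "i \<le> k" "k + int (length s) \<le> i + int n" "occurs_at s x k"
proof -
  obtain a b where ab: "window x i n = a @ s @ b" using assms by (auto simp: sublist_def)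
  then have n: "n = length a + length s + length b" by (metis length_append length_window add.assoc)
  have "occurs_at (a @ s @ b) x i" using ab occurs_at_window[of x i n] by simp
  then have "occurs_at s x (i + int (length a))" by (simp add: occurs_at_append)
  then show ?thesis using that[of "i + int (length a)"] n by simp
qed

lemma sublist_takeD: "sublist s (take m v) \<Longrightarrow> sublist s v"
  by (metis append_take_drop_id append.assoc sublist_def)

context synchronized_code
begin

text \<open>
  The map induced on words by the block code; a word loses \<open>r\<close> letters at both ends.
\<close>
definition block_image :: "'a list \<Rightarrow> 'b list" where
  "block_image v = (SOME u. \<exists>x\<in>X. \<exists>i. occurs_at v x i \<and> u = window (\<pi> x) (i + int r) (length v - 2 * r))"

lemma block_image_window:
  assumes x: "x \<in> X"
  shows "block_image (window x i (n + 2 * r)) = window (\<pi> x) (i + int r) n"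
proof -
  let ?P = "\<lambda>u. \<exists>x'\<in>X. \<exists>i'. occurs_at (window x i (n + 2 * r)) x' i' \<and>
     u = window (\<pi> x') (i' + int r) (length (window x i (n + 2 * r)) - 2 * r)"
  have "?P (window (\<pi> x) (i + int r) n)" using x by (auto intro!: bexI[of _ x] exI[of _ i])
  then have "?P (block_image (window x i (n + 2 * r)))" unfolding block_image_def by (rule someI)
  then obtain x' i' where x': "x' \<in> X" "occurs_at (window x i (n + 2 * r)) x' i'"
    "block_image (window x i (n + 2 * r)) = window (\<pi> x') (i' + int r) n" by auto
  then have "window x' i' (n + 2 * r) = window x i (n + 2 * r)" by (simp add: occurs_at_iff_window)
  then show ?thesis using block_radius_window[OF radius x'(1) x] x'(3) by simp
qed

definition closed_words :: "nat \<Rightarrow> 'a list set" where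
  "closed_words n = {w \<in> language X. length w = n \<and> prefix s w \<and> suffix s w}"

lemma block_image_inj_on_closed_words: "inj_on block_image (closed_words n)"
proof (rule inj_onI)
  fix w w' assume w: "w \<in> closed_words n" "w' \<in> closed_words n" and eq: "block_image w = block_image w'"
  have len: "length w = n" "length w' = n" using w by (auto simp: closed_words_def)
  have "length s \<le> n" using w(1) by (auto simp: closed_words_def dest: prefix_length_le)
  then obtain l where l: "n = l + length s" by (metis add.commute le_Suc_ex)
  have "w \<in> language X" "w' \<in> language X" using w by (auto simp: closed_words_def)
  then obtain x x' where x: "x \<in> X" "occurs_at w x 0" "x' \<in> X" "occurs_at w' x' 0"
    using language_at[OF X] by metis
  then have wx: "window x 0 n = w" "window x' 0 n = w'" by (simp_all add: occurs_at_iff_window len)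
  have oc: "occurs_at s z 0" "occurs_at s z (int l)" if "occurs_at v z 0" "v \<in> closed_words n" for v z
  proof -
    obtain e where "v = s @ e" using \<open>v \<in> closed_words n\<close> by (auto simp: closed_words_def prefix_def)
    then show "occurs_at s z 0" using that(1) by (simp add: occurs_at_append)
    obtain e where "v = e @ s" using \<open>v \<in> closed_words n\<close> by (auto simp: closed_words_def suffix_def)
    moreover have "length v = n" using that(2) by (simp add: closed_words_def)
    ultimately show "occurs_at s z (int l)" using that(1) l by (simp add: occurs_at_append)
  qed
  define h where "h = n - 2 * r"
  have h: "n = h + 2 * r" using l long by (simp add: h_def)
  have "window (\<pi> x) (int r) h = window (\<pi> x') (int r) h"
    using eq block_image_window[OF x(1), of 0 h] block_image_window[OF x(3), of 0 h] wx by (simp add: h)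
  then have im: "\<pi> x k = \<pi> x' k" if "int r \<le> k" "k < int l + int (length s) - int r" for k
    using that h l by (simp add: window_eq_same_iff)
  have "x k = x' k" if "0 \<le> k" "k < int l + int (length s)" for k
    using no_diamond[OF x(1,3) oc(1)[OF x(2) w(1)] oc(1)[OF x(4) w(2)] oc(2)[OF x(2) w(1)]
        oc(2)[OF x(4) w(2)] im that] .
  then have "window x 0 n = window x' 0 n" by (simp add: window_eq_same_iff l)
  then show "w = w'" by (simp add: wx)
qed

definition free_words :: "nat \<Rightarrow> 'a list set" where
  "free_words n = {v \<in> language X. length v = n \<and> \<not> sublist s v}"

lemma finite_free_words: "finite (free_words n)"
  unfolding free_words_def by (rule finite_subset[OF _ finite_words_of_length[OF X, of n]]) auto

lemma finite_closed_words: "finite (closed_words n)"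
  unfolding closed_words_def by (rule finite_subset[OF _ finite_words_of_length[OF X, of n]]) auto

text \<open>
  A count of words, in place of the comparison of entropies. If every word of \<open>Y\<close> had a preimage in
  which \<open>s\<close> does not occur, then \<open>Y\<close> would have at most as many words of length \<open>n\<close> as there are
  \<open>s\<close>-free words of length \<open>n + 2 * r\<close> in \<open>X\<close>. On the other hand, cutting an \<open>s\<close>-free word of length \<open>m\<close>
  at any of its \<open>m\<close> positions, inserting a bridge that contains \<open>s\<close>, and closing up with \<open>s\<close> at both
  ends produces, up to a bounded multiplicity, \<open>m\<close> times as many words as there are \<open>s\<close>-free words of
  length \<open>m\<close>; by the absence of diamonds these have different images. Since the lengths differ from
  \<open>m\<close> by a bounded amount only, the two estimates contradict each other for large \<open>m\<close>.
\<close>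
lemma exists_word_forcing_sync:
  assumes ne: "X \<noteq> {}"
  shows "\<exists>u\<in>language Y. \<forall>x\<in>X. \<forall>j. occurs_at u (\<pi> x) j \<longrightarrow>
    (\<exists>i. j - int r \<le> i \<and> i + int (length s) \<le> j + int (length u) + int r \<and> occurs_at s x i)"
proof (rule ccontr)
  assume "\<not> ?thesis"
  then have neg: "\<exists>x\<in>X. \<exists>j. occurs_at u (\<pi> x) j \<and>
      \<not> (\<exists>i. j - int r \<le> i \<and> i + int (length s) \<le> j + int (length u) + int r \<and> occurs_at s x i)"
    if "u \<in> language Y" for u using that by blast
  let ?L = "language X"
  have sL: "s \<in> ?L" using sync by (simp add: synchronizing_def)
  have Y_le: "card {u \<in> language Y. length u = n} \<le> card (free_words (n + 2 * r))" for n
  proof (rule surj_card_le[OF finite_free_words], rule subsetI)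
    fix u assume u: "u \<in> {u \<in> language Y. length u = n}"
    then obtain x j where x: "x \<in> X" "occurs_at u (\<pi> x) j" and
      no: "\<not> (\<exists>i. j - int r \<le> i \<and> i + int (length s) \<le> j + int (length u) + int r \<and> occurs_at s x i)"
      using neg[of u] by blast
    let ?v = "window x (j - int r) (n + 2 * r)"
    have "\<not> sublist s ?v"
    proof
      assume "sublist s ?v"
      then obtain k where "j - int r \<le> k" "k + int (length s) \<le> j - int r + int (n + 2 * r)" "occurs_at s x k"
        by (rule sublist_windowE)
      then show False using no u by auto
    qed
    then have "?v \<in> free_words (n + 2 * r)" using x(1) by (simp add: free_words_def window_in_language)
    moreover have "block_image ?v = u"
      using block_image_window[OF x(1), of "j - int r" n] x(2) u by (simp add: occurs_at_iff_window)
    ultimately show "u \<in> block_image ` free_words (n + 2 * r)" by blast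
  qed
  obtain A where A: "finite A" "?L \<subseteq> lists A" using finite_words[OF X] .
  have "s \<noteq> []" using long by auto
  then have "A \<noteq> {}" using sL A(2) by (cases s) auto
  then have A1: "1 \<le> card A" using A(1) by (simp add: Suc_leI card_gt_0_iff)
  have free_add: "card (free_words (m + k)) \<le> card (free_words m) * card A ^ k" for m k
  proof -
    let ?f = "\<lambda>v. (take m v, drop m v)"
    have inj: "inj_on ?f (free_words (m + k))"
      by (rule inj_onI) (metis append_take_drop_id prod.inject)
    have "?f v \<in> free_words m \<times> {l. set l \<subseteq> A \<and> length l = k}" if v: "v \<in> free_words (m + k)" for v
    proof -
      have vL: "take m v @ drop m v \<in> ?L" "length v = m + k" "\<not> sublist s v" using v by (auto simp: free_words_def)
      moreover have "\<not> sublist s (take m v)"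
        using vL(3) sublist_takeD by blast
      moreover have "drop m v \<in> lists A" using language_appendD(2)[OF vL(1)] A(2) by blast
      ultimately show ?thesis using language_appendD(1)[OF vL(1)] by (auto simp: free_words_def)
    qed
    then have "card (free_words (m + k)) \<le> card (free_words m \<times> {l. set l \<subseteq> A \<and> length l = k})"
      using A(1) by (intro card_inj_on_le[OF inj]) (auto intro: finite_free_words finite_lists_length_eq)
    then show ?thesis using A(1) by (simp add: card_cartesian_product card_lists_length_eq)
  qed
  have closed_le: "card (closed_words n) \<le> card (free_words n)" for n
  proof (cases "closed_words n = {}")
    case False
    then obtain w where "w \<in> closed_words n" by blast
    then have "length s \<le> n" by (auto simp: closed_words_def dest: prefix_length_le)
    then have n: "n = (n - 2 * r) + 2 * r" using long by simp
    have "block_image ` closed_words n \<subseteq> {u \<in> language Y. length u = n - 2 * r}"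
    proof
      fix u assume "u \<in> block_image ` closed_words n"
      then obtain w where w: "w \<in> closed_words n" "u = block_image w" by blast
      then have "w \<in> ?L" "length w = n" by (auto simp: closed_words_def)
      then obtain x where x: "x \<in> X" "occurs_at w x 0" using language_at[OF X] by metis
      then have "w = window x 0 ((n - 2 * r) + 2 * r)" using \<open>length w = n\<close> n by (simp add: occurs_at_iff_window)
      then have "u = window (\<pi> x) (0 + int r) (n - 2 * r)"
        using w(2) block_image_window[OF x(1)] by blast
      moreover have "\<pi> x \<in> Y" using x(1) surj by blast
      ultimately show "u \<in> {u \<in> language Y. length u = n - 2 * r}" by (simp add: window_in_language)
    qed
    then have "card (closed_words n) \<le> card {u \<in> language Y. length u = n - 2 * r}"
      using card_inj_on_le[OF block_image_inj_on_closed_words _ finite_words_of_length[OF Y]] by blast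
    also have "\<dots> \<le> card (free_words n)" using Y_le[of "n - 2 * r"] n by simp
    finally show ?thesis .
  qed simp
  obtain C where C: "\<And>u w. u \<in> ?L \<Longrightarrow> w \<in> ?L \<Longrightarrow> \<exists>q. length q \<le> C \<and> sublist s q \<and> u @ q @ w \<in> ?L"
    using bounded_bridges[OF sofic irreducible sL] by blast
  define br where "br u w = (SOME q. length q \<le> C \<and> sublist s q \<and> u @ q @ w \<in> ?L)" for u w
  have br: "length (br u w) \<le> C" "sublist s (br u w)" "u @ br u w @ w \<in> ?L" if "u \<in> ?L" "w \<in> ?L" for u w
    using someI_ex[OF C[OF that]] unfolding br_def by blast+
  define K where "K = 3 * C + 2 * length s"
  define c where "c = (\<Sum>k\<le>K. card A ^ k) * ((C + 1) * ((C + 1) * (C + length s + 1)))"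
  have bound: "m * card (free_words m) \<le> c * card (free_words m)" for m
  proof -
    \<comment> \<open>The pair \<open>(v, t)\<close> stands for the \<open>s\<close>-free word \<open>v\<close> cut at \<open>t\<close>. It can be read off from the
        resulting word, the lengths of two bridges, and the bounded distance \<open>\<delta>\<close> between the cut and
        the end of the first \<open>s\<close>: as \<open>v\<close> is free of \<open>s\<close>, the first \<open>s\<close> cannot end before the cut.\<close>
    define q where "q = (\<lambda>(v, t). br (take t v) (drop t v))"
    define core where "core = (\<lambda>(v, t). take t v @ q (v, t) @ drop t v)"
    define a where "a p = br s (core p)" for p
    define b where "b p = br (s @ a p @ core p) s" for p
    define R where "R p = core p @ b p @ s" for p
    define first where "first l = (LEAST k. \<exists>e g. l = e @ s @ g \<and> length e = k)" for l
    define \<delta> where "\<delta> p = first (R p) + length s - snd p" for p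
    define \<Psi> where "\<Psi> p = (s @ a p @ R p, length (a p), length (q p), \<delta> p)" for p
    let ?D = "free_words m \<times> {0..<m}"
    have props: "length (q (v, t)) \<le> C \<and> length (a (v, t)) \<le> C \<and> length (b (v, t)) \<le> C \<and>
        s @ a (v, t) @ R (v, t) \<in> ?L \<and> t < first (R (v, t)) + length s \<and> first (R (v, t)) \<le> t + C"
      if p: "(v, t) \<in> ?D" for v t
    proof -
      have v: "take t v @ drop t v \<in> ?L" "length v = m" "\<not> sublist s v" "t < m" using p by (auto simp: free_words_def)
      note q' = br[OF language_appendD[OF v(1)]]
      have core: "core (v, t) \<in> ?L" using q'(3) by (simp add: core_def q_def)
      note a' = br[OF sL core]
      note b' = br[OF a'(3) sL]
      have ql: "length (q (v, t)) \<le> C" "sublist s (q (v, t))" using q' by (auto simp: q_def)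
      then obtain e g where eg: "q (v, t) = e @ s @ g" by (auto simp: sublist_def)
      let ?P = "\<lambda>k. \<exists>e g. R (v, t) = e @ s @ g \<and> length e = k"
      have "R (v, t) = (take t v @ e) @ s @ (g @ drop t v @ b (v, t) @ s)"
        by (simp add: R_def core_def eg)
      then have ex: "?P (t + length e)" using v by (intro exI[of _ "take t v @ e"] exI conjI) auto
      have f1: "first (R (v, t)) \<le> t + C"
        using Least_le[of ?P, OF ex] ql(1) eg by (simp add: first_def)
      have "?P (first (R (v, t)))" unfolding first_def by (rule LeastI[of ?P, OF ex])
      then obtain e' g' where e': "R (v, t) = e' @ s @ g'" "length e' = first (R (v, t))" by blast
      have f2: "t < first (R (v, t)) + length s"
      proof (rule ccontr)
        assume "\<not> t < first (R (v, t)) + length s"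
        then have "take t (R (v, t)) = e' @ s @ take (t - length e' - length s) g'" using e' by simp
        moreover have "take t (R (v, t)) = take t v" using v by (simp add: R_def core_def)
        ultimately have "sublist s (take t v)" by (auto simp: sublist_def)
        then have "sublist s v" by (rule sublist_takeD)
        then show False using v(3) by simp
      qed
      show ?thesis using ql f1 f2 a' b' by (simp add: a_def b_def R_def)
    qed
    have len: "length (s @ a p @ R p) = m + (length (q p) + length (a p) + length (b p) + 2 * length s)"
      if "p \<in> ?D" for p
      using that by (auto simp: R_def core_def free_words_def)
    have "inj_on \<Psi> ?D"
    proof (rule inj_onI)
      fix p p' assume p: "p \<in> ?D" "p' \<in> ?D" and eq: "\<Psi> p = \<Psi> p'"
      obtain v t v' t' where pp: "p = (v, t)" "p' = (v', t')" by (metis surj_pair)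
      have al: "length (a p) = length (a p')" and ql: "length (q p) = length (q p')" and dl: "\<delta> p = \<delta> p'"
        and wl: "s @ a p @ R p = s @ a p' @ R p'" using eq by (auto simp: \<Psi>_def)
      have R: "R p = R p'" using wl al by simp
      have "first (R p) + length s - t = first (R p) + length s - t'"
        using dl R by (simp add: \<delta>_def pp)
      moreover have "t < first (R p) + length s" using props[of v t] p(1) pp(1) by blast
      moreover have "t' < first (R p) + length s" using props[of v' t'] p(2) pp(2) R by metis
      ultimately have t: "t = t'" by linarith
      have rec: "take t (R (v, t)) @ take (m - t) (drop (t + length (q (v, t))) (R (v, t))) = v"
        if "(v, t) \<in> ?D" for v t
        using that by (auto simp: R_def core_def free_words_def)
      have "v = take t (R p) @ take (m - t) (drop (t + length (q p)) (R p))"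
        unfolding pp(1) by (rule rec[OF p(1)[unfolded pp(1)], symmetric])
      also have "\<dots> = v'"
        unfolding R ql t unfolding pp(2) by (rule rec[OF p(2)[unfolded pp(2)]])
      finally have "v = v'" .
      then show "p = p'" using pp t by simp
    qed
    moreover have "\<Psi> ` ?D \<subseteq> (\<Union>k\<le>K. closed_words (m + k)) \<times> ({..C} \<times> ({..C} \<times> {..C + length s}))"
    proof
      fix z assume "z \<in> \<Psi> ` ?D"
      then obtain v t where vt: "(v, t) \<in> ?D" "z = \<Psi> (v, t)" by auto
      define k where "k = length (q (v, t)) + length (a (v, t)) + length (b (v, t)) + 2 * length s"
      have "k \<le> K" using props[OF vt(1)] by (simp add: k_def K_def)
      moreover have "s @ a (v, t) @ R (v, t) \<in> closed_words (m + k)"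
        using props[OF vt(1)] len[OF vt(1)] unfolding closed_words_def k_def
        by (auto simp: R_def suffix_def)
      ultimately show "z \<in> (\<Union>k\<le>K. closed_words (m + k)) \<times> ({..C} \<times> ({..C} \<times> {..C + length s}))"
        using props[OF vt(1)] vt(2) by (auto simp: \<Psi>_def \<delta>_def)
    qed
    ultimately have "card ?D \<le> card ((\<Union>k\<le>K. closed_words (m + k)) \<times> ({..C} \<times> ({..C} \<times> {..C + length s})))"
      by (rule card_inj_on_le) (simp add: finite_closed_words)
    also have "\<dots> = card (\<Union>k\<le>K. closed_words (m + k)) * ((C + 1) * ((C + 1) * (C + length s + 1)))"
      by (simp add: card_cartesian_product)
    also have "\<dots> \<le> (\<Sum>k\<le>K. card (free_words m) * card A ^ k) * ((C + 1) * ((C + 1) * (C + length s + 1)))"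
    proof (rule mult_le_mono1)
      have "card (\<Union>k\<le>K. closed_words (m + k)) \<le> (\<Sum>k\<le>K. card (closed_words (m + k)))"
        by (rule card_UN_le) simp
      also have "\<dots> \<le> (\<Sum>k\<le>K. card (free_words m) * card A ^ k)"
        by (rule sum_mono) (meson closed_le free_add order_trans)
      finally show "card (\<Union>k\<le>K. closed_words (m + k)) \<le> (\<Sum>k\<le>K. card (free_words m) * card A ^ k)" .
    qed
    also have "\<dots> = c * card (free_words m)" 
      unfolding c_def sum_distrib_left[symmetric] by (simp only: mult_ac)
    finally show ?thesis by (simp add: card_cartesian_product mult.commute)
  qed
  obtain x where "x \<in> X" using ne by blast
  then have "window (\<pi> x) 0 (c + 1) \<in> {u \<in> language Y. length u = c + 1}"
    using surj by (auto intro: window_in_language)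
  then have "0 < card {u \<in> language Y. length u = c + 1}"
    using finite_words_of_length[OF Y] by (auto simp: card_gt_0_iff)
  then have "0 < card (free_words (c + 1 + 2 * r))" using Y_le[of "c + 1"] by linarith
  then have "c + 1 + 2 * r \<le> c" using bound[of "c + 1 + 2 * r"] by (simp only: mult_le_cancel2)
  then show False by simp
qed

end

section \<open>The number of preimages of doubly transitive points\<close>

lemma doubly_transitive_recurrence:
  assumes "doubly_transitive Y y" "y0 \<in> Y"
  shows "\<exists>k\<ge>N. \<forall>i\<in>{a..<b}. y (i + k) = y0 i" and "\<exists>k\<le>N. \<forall>i\<in>{a..<b}. y (i + k) = y0 i"
proof -
  let ?w = "window y0 a (nat (b - a))"
  have w: "?w \<in> language Y" using assms(2) by (rule window_in_language)
  have rec: "\<forall>i\<in>{a..<b}. y (i + (l - a)) = y0 i" if "occurs_at ?w y l" for l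
  proof -
    have "window (translate (l - a) y) a (nat (b - a)) = ?w"
      using that by (simp add: occurs_at_iff_window window_translate)
    then show ?thesis by (cases "a \<le> b") (simp_all add: window_eq_same_iff translate_apply)
  qed
  obtain l where "l \<ge> N + a" "occurs_at ?w y l"
    using assms(1) w unfolding doubly_transitive_def by blast
  then show "\<exists>k\<ge>N. \<forall>i\<in>{a..<b}. y (i + k) = y0 i"
    using rec[of l] by (intro exI[of _ "l - a"]) auto
  obtain l where "l \<le> N + a" "occurs_at ?w y l"
    using assms(1) w unfolding doubly_transitive_def by blast
  then show "\<exists>k\<le>N. \<forall>i\<in>{a..<b}. y (i + k) = y0 i"
    using rec[of l] by (intro exI[of _ "l - a"]) auto
qed

context synchronized_code
begin

text \<open>
  The occurrence of \<open>s\<close> lies in the window of \<open>x\<close> that determines \<open>u\<close>.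
\<close>
definition forcing :: "'b list \<Rightarrow> bool" where
  "forcing u \<longleftrightarrow> u \<in> language Y \<and> (\<forall>x\<in>X. \<forall>j. occurs_at u (\<pi> x) j \<longrightarrow>
     (\<exists>i. j - int r \<le> i \<and> i + int (length s) \<le> j + int (length u) + int r \<and> occurs_at s x i))"

definition cover_block :: "'b list \<Rightarrow> (int \<Rightarrow> 'a) \<Rightarrow> int \<Rightarrow> 'a list" where
  "cover_block u x j = window x (j - int r) (length u + 2 * r)"

definition blocks_over :: "'b list \<Rightarrow> (int \<Rightarrow> 'b) \<Rightarrow> int \<Rightarrow> int \<Rightarrow> int \<Rightarrow> 'a list set" where
  "blocks_over u y a b j = {cover_block u x j | x. x \<in> X \<and> (\<forall>i\<in>{a..<b}. \<pi> x i = y i)}"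

lemma cover_block_eqD:
  assumes "cover_block u x j = cover_block u x' j" "j - int r \<le> i" "i < j + int (length u) + int r"
  shows "x i = x' i"
  using assms by (simp add: cover_block_def window_eq_same_iff)

lemma finite_blocks_over: "finite (blocks_over u y a b j)"
  by (rule finite_subset[OF _ finite_words_of_length[OF X, of "length u + 2 * r"]])
     (auto simp: blocks_over_def cover_block_def window_in_language)

lemma blocks_over_mono:
  "a' \<le> a \<Longrightarrow> b \<le> b' \<Longrightarrow> blocks_over u y a' b' j \<subseteq> blocks_over u y a b j"
  by (fastforce simp: blocks_over_def)

lemma blocks_over_translate:
  assumes "\<forall>i\<in>{a..<b}. y (i + k) = y' i"
  shows "blocks_over u y (a + k) (b + k) (j + k) = blocks_over u y' a b j"
proof (intro equalityI subsetI)
  fix B assume "B \<in> blocks_over u y (a + k) (b + k) (j + k)"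
  then obtain x where x: "x \<in> X" "\<forall>i\<in>{a + k..<b + k}. \<pi> x i = y i" "B = cover_block u x (j + k)"
    by (auto simp: blocks_over_def)
  moreover have "cover_block u (translate k x) j = B"
    by (simp add: x(3) cover_block_def window_translate algebra_simps)
  moreover have "\<forall>i\<in>{a..<b}. \<pi> (translate k x) i = y' i"
    using assms x by (simp add: factor_code_translate[OF code] translate_apply)
  ultimately show "B \<in> blocks_over u y' a b j"
    unfolding blocks_over_def using shift_space_translate_in[OF X x(1), of k]
    by (intro CollectI exI[of _ "translate k x"]) simp
next
  fix B assume "B \<in> blocks_over u y' a b j"
  then obtain x where x: "x \<in> X" "\<forall>i\<in>{a..<b}. \<pi> x i = y' i" "B = cover_block u x j"
    by (auto simp: blocks_over_def)
  moreover have "cover_block u (translate (- k) x) (j + k) = B"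
    by (simp add: x(3) cover_block_def window_translate algebra_simps)
  moreover have "\<pi> (translate (- k) x) i = y i" if "i \<in> {a + k..<b + k}" for i
    using assms[rule_format, of "i - k"] x that
    by (simp add: factor_code_translate[OF code] translate_apply)
  ultimately show "B \<in> blocks_over u y (a + k) (b + k) (j + k)"
    unfolding blocks_over_def using shift_space_translate_in[OF X x(1), of "- k"]
    by (intro CollectI exI[of _ "translate (- k) x"]) simp
qed

text \<open>
  Above \<open>u\<close> every block contains \<open>s\<close> somewhere, so two points with the same block have a common
  occurrence of \<open>s\<close> along which they can be spliced. The images splice as well, and for \<open>i\<close> in
  the interval covered by \<open>u\<close> both descriptions of \<open>\<pi> z i\<close> hold.
\<close>
lemma splice_at_equal_blocks:
  assumes u: "forcing u" and x: "x \<in> X" "x' \<in> X" and oc: "occurs_at u (\<pi> x) j"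
    and eq: "cover_block u x j = cover_block u x' j"
  obtains z where "z \<in> X"
    "\<And>i. i < j + int (length u) + int r \<Longrightarrow> z i = x i" "\<And>i. j - int r \<le> i \<Longrightarrow> z i = x' i"
    "\<And>i. i < j + int (length u) \<Longrightarrow> \<pi> z i = \<pi> x i" "\<And>i. j \<le> i \<Longrightarrow> \<pi> z i = \<pi> x' i"
proof -
  obtain p where p: "j - int r \<le> p" "p + int (length s) \<le> j + int (length u) + int r" "occurs_at s x p"
    using u x(1) oc unfolding forcing_def by blast
  have "occurs_at s x' p"
    using p(3) by (rule iffD1[OF occurs_at_agree, rotated]) (use p in \<open>auto intro!: cover_block_eqD[OF eq]\<close>)
  define z where "z = splice_at p x x'"
  have zX: "z \<in> X"
    unfolding z_def by (rule splice_at_in[OF X sync x p(3) \<open>occurs_at s x' p\<close>])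
  have zl: "z i = x i" if "i < j + int (length u) + int r" for i
    using that p(1) cover_block_eqD[OF eq, of i] by (auto simp: z_def splice_at_def)
  have zr: "z i = x' i" if "j - int r \<le> i" for i
    using that p cover_block_eqD[OF eq, of i] by (auto simp: z_def splice_at_def)
  have "\<pi> z i = \<pi> x i" if "i < j + int (length u)" for i
    using that by (intro block_radiusD[OF radius zX x(1)] zl) auto
  moreover have "\<pi> z i = \<pi> x' i" if "j \<le> i" for i
    using that by (intro block_radiusD[OF radius zX x(2)] zr) auto
  ultimately show ?thesis using that zX zl zr by blast
qed

end

text \<open>
  A window \<open>[a0, b0)\<close> of a point \<open>y0\<close> that contains \<open>u\<close> at \<open>j0\<close> and has the fewest preimage blocks over
  that occurrence of \<open>u\<close>, among all windows containing \<open>u\<close>. Enlarging such a window does not lose any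
  of its blocks; this is the reason for minimizing.
\<close>
locale magic_word = synchronized_code +
  fixes u :: "'b list" and y0 :: "int \<Rightarrow> 'b" and a0 b0 j0 :: int
  assumes u: "forcing u"
    and y0: "y0 \<in> Y" and u_y0: "occurs_at u y0 j0" and a0: "a0 \<le> j0" and b0: "j0 + int (length u) \<le> b0"
    and minimal: "\<And>y a b j. y \<in> Y \<Longrightarrow> occurs_at u y j \<Longrightarrow> a \<le> j \<Longrightarrow> j + int (length u) \<le> b \<Longrightarrow>
      card (blocks_over u y0 a0 b0 j0) \<le> card (blocks_over u y a b j)"
begin

abbreviation blocks :: "'a list set" where
  "blocks \<equiv> blocks_over u y0 a0 b0 j0"

abbreviation block :: "(int \<Rightarrow> 'a) \<Rightarrow> int \<Rightarrow> 'a list" where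
  "block x k \<equiv> cover_block u x (j0 + k)"

definition magic_at :: "(int \<Rightarrow> 'b) \<Rightarrow> int \<Rightarrow> bool" where
  "magic_at y k \<longleftrightarrow> (\<forall>i\<in>{a0..<b0}. y (i + k) = y0 i)"

lemma magic_at_occurs: "magic_at y k \<Longrightarrow> occurs_at u y (j0 + k)"
proof -
  assume m: "magic_at y k"
  have "occurs_at u y0 j0 \<longleftrightarrow> occurs_at u (translate k y) j0"
    using m a0 b0 by (intro occurs_at_agree) (simp add: magic_at_def translate_apply)
  then show ?thesis using u_y0 by (simp add: occurs_at_translate)
qed

lemma blocks_over_magic:
  assumes "y \<in> Y" "magic_at y k" "a \<le> a0 + k" "b0 + k \<le> b"
  shows "blocks_over u y a b (j0 + k) = blocks"
proof (rule card_subset_eq[OF finite_blocks_over])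
  show sub: "blocks_over u y a b (j0 + k) \<subseteq> blocks"
    using blocks_over_mono[OF assms(3,4), of u y "j0 + k"] blocks_over_translate[of a0 b0 y k y0 u j0] assms(2)
    by (simp add: magic_at_def)
  show "card (blocks_over u y a b (j0 + k)) = card blocks"
    using minimal[OF assms(1) magic_at_occurs[OF assms(2)], of a b] a0 b0 assms(3,4)
      card_mono[OF finite_blocks_over sub] by linarith
qed

lemma block_in_blocks:
  assumes "x \<in> X" "magic_at (\<pi> x) k"
  shows "block x k \<in> blocks"
proof -
  have "block x k \<in> blocks_over u (\<pi> x) (a0 + k) (b0 + k) (j0 + k)"
    using assms(1) by (auto simp: blocks_over_def)
  moreover have "\<pi> x \<in> Y" using assms(1) surj by blast
  ultimately show ?thesis using blocks_over_magic[OF _ assms(2)] by blast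
qed

text \<open>
  By minimality \<open>B\<close> survives in preimages of arbitrarily long windows of \<open>y\<close>; compactness then
  gives a preimage of \<open>y\<close> itself.
\<close>
lemma preimage_through_block:
  assumes y: "y \<in> Y" "magic_at y k" and B: "B \<in> blocks"
  obtains x where "x \<in> X" "\<pi> x = y" "block x k = B"
proof -
  have lenB: "length B = length u + 2 * r" using B by (auto simp: blocks_over_def cover_block_def)
  have "\<exists>x\<in>X. \<forall>n. (\<forall>i\<in>{- int n..int n}. \<pi> x i = y i) \<and> block x k = B"
  proof (rule compact_nested_points[OF compact_shift_space[OF X]])
    fix n
    have "closed (X \<inter> \<pi> -` {z. \<forall>i\<in>{- int n..int n}. z i = y i})"
      using code compact_imp_closed X unfolding factor_code_def
      by (intro continuous_closed_preimage closed_cylinder) (auto simp: shift_space_def)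
    moreover have "closed {x::int \<Rightarrow> 'a. occurs_at B x (j0 + k - int r)}" by (rule closed_occurs_at)
    moreover have "{x \<in> X. (\<forall>i\<in>{- int n..int n}. \<pi> x i = y i) \<and> block x k = B} =
      (X \<inter> \<pi> -` {z. \<forall>i\<in>{- int n..int n}. z i = y i}) \<inter> {x. occurs_at B x (j0 + k - int r)}"
      by (auto simp: occurs_at_iff_window cover_block_def lenB)
    ultimately show "closed {x \<in> X. (\<forall>i\<in>{- int n..int n}. \<pi> x i = y i) \<and> block x k = B}"
      by (simp only: closed_Int)
    have "B \<in> blocks_over u y (min (- int n) (a0 + k)) (max (int n + 1) (b0 + k)) (j0 + k)"
      using blocks_over_magic[OF y] B by simp
    then obtain x where "x \<in> X" "block x k = B"
      "\<forall>i\<in>{min (- int n) (a0 + k)..<max (int n + 1) (b0 + k)}. \<pi> x i = y i"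
      by (auto simp: blocks_over_def)
    moreover have "{- int n..int n} \<subseteq> {min (- int n) (a0 + k)..<max (int n + 1) (b0 + k)}" by auto
    ultimately show "\<exists>x\<in>X. (\<forall>i\<in>{- int n..int n}. \<pi> x i = y i) \<and> block x k = B"
      by blast
  qed auto
  then obtain x where x: "x \<in> X" "\<And>n i. i \<in> {- int n..int n} \<Longrightarrow> \<pi> x i = y i" "block x k = B" by blast
  have "\<pi> x = y"
  proof
    fix i :: int
    have "- int (nat \<bar>i\<bar>) \<le> i" "i \<le> int (nat \<bar>i\<bar>)" by linarith+
    then show "\<pi> x i = y i" using x(2)[of i "nat \<bar>i\<bar>"] by simp
  qed
  then show ?thesis using that x(1,3) by blast
qed

text \<open>
  When \<open>y = \<pi> x\<close> repeats at distance \<open>t\<close> a stretch that starts and ends with the magic window, the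
  corresponding stretch of \<open>x\<close> can be moved there: \<open>z\<close> follows \<open>f\<close>, then the translate of \<open>x\<close>, and then
  some preimage of \<open>y\<close> through the block in which that stretch ends.
\<close>
lemma transplant:
  assumes x: "x \<in> X" and k: "magic_at (\<pi> x) k" "magic_at (\<pi> x) k'" "k \<le> k'"
    and t: "\<forall>i\<in>{a0 + k..<b0 + k'}. \<pi> x (i + t) = \<pi> x i"
    and f: "f \<in> X" "\<pi> f = \<pi> x" "block f (k + t) = block x k"
  obtains z where "z \<in> X" "\<pi> z = \<pi> x"
    "\<And>i. i < j0 + k + t + int (length u) + int r \<Longrightarrow> z i = f i"
    "\<And>i. j0 + k - int r \<le> i \<Longrightarrow> i < j0 + k' + int (length u) + int r \<Longrightarrow> z (i + t) = x i"
proof -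
  let ?y = "\<pi> x" and ?U = "int (length u)"
  have yY: "?y \<in> Y" using x surj by blast
  have kt: "magic_at ?y (k + t)" "magic_at ?y (k' + t)"
  proof -
    have "?y (i + (l + t)) = y0 i" if "i \<in> {a0..<b0}" "l = k \<or> l = k'" for i l
      using t[rule_format, of "i + l"] k that by (auto simp: magic_at_def algebra_simps)
    then show "magic_at ?y (k + t)" "magic_at ?y (k' + t)" by (auto simp: magic_at_def)
  qed
  define x' where "x' = translate (- t) x"
  have x': "x' \<in> X" using x by (simp add: x'_def shift_space_translate_in[OF X])
  have \<pi>x': "\<pi> x' i = ?y (i - t)" for i
    using x by (simp add: x'_def factor_code_translate[OF code] translate_apply)
  have bl: "block x' (l + t) = block x l" for l
    by (simp add: x'_def cover_block_def window_translate algebra_simps)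
  have ocf: "occurs_at u (\<pi> f) (j0 + (k + t))" using magic_at_occurs[OF kt(1)] f(2) by simp
  have blf: "block f (k + t) = block x' (k + t)" using f(3) bl[of k] by simp
  obtain h where h: "h \<in> X" "\<And>i. i < j0 + (k + t) + ?U + int r \<Longrightarrow> h i = f i"
    "\<And>i. j0 + (k + t) - int r \<le> i \<Longrightarrow> h i = x' i"
    "\<And>i. i < j0 + (k + t) + ?U \<Longrightarrow> \<pi> h i = \<pi> f i" "\<And>i. j0 + (k + t) \<le> i \<Longrightarrow> \<pi> h i = \<pi> x' i"
    using splice_at_equal_blocks[OF u f(1) x' ocf blf] by metis
  have h_y: "\<pi> h i = ?y i" if "i < j0 + k' + t + ?U" for i
  proof (cases "i < j0 + k + t")
    case False
    then show ?thesis using t[rule_format, of "i - t"] h(5)[of i] \<pi>x'[of i] that a0 b0 by auto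
  qed (use h(4) f(2) in auto)
  have "block x k' \<in> blocks" using x k by (intro block_in_blocks) auto
  then obtain g where g: "g \<in> X" "\<pi> g = ?y" "block g (k' + t) = block x k'"
    using preimage_through_block[OF yY kt(2)] by metis
  have "block h (k' + t) = block x' (k' + t)"
    unfolding cover_block_def window_eq_same_iff using k(3) h(3) by auto
  then have eq: "block h (k' + t) = block g (k' + t)" using g(3) bl by simp
  have "occurs_at u (\<pi> h) (j0 + (k' + t))"
    using magic_at_occurs[OF kt(2)]
    by (rule iffD1[OF occurs_at_agree, rotated]) (use h_y in auto)
  then obtain z where z: "z \<in> X" "\<And>i. i < j0 + (k' + t) + ?U + int r \<Longrightarrow> z i = h i"
    "\<And>i. i < j0 + (k' + t) + ?U \<Longrightarrow> \<pi> z i = \<pi> h i" "\<And>i. j0 + (k' + t) \<le> i \<Longrightarrow> \<pi> z i = \<pi> g i"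
    using splice_at_equal_blocks[OF u h(1) g(1) _ eq] by metis
  show ?thesis
  proof (rule that[OF z(1)])
    have "\<pi> z i = ?y i" for i
      using z(3)[of i] z(4)[of i] h_y[of i] g(2) by (cases "i < j0 + k' + t") auto
    then show "\<pi> z = ?y" by blast
    show "z i = f i" if "i < j0 + k + t + int (length u) + int r" for i
      using z(2)[of i] h(2)[of i] that k(3) by simp
    show "z (i + t) = x i" if "j0 + k - int r \<le> i" "i < j0 + k' + int (length u) + int r" for i
      using z(2)[of "i + t"] h(3)[of "i + t"] that by (simp add: x'_def translate_apply)
  qed
qed

text \<open>
  If \<open>x\<close> and \<open>x'\<close> had a common block and then diverged, the divergence could be transplanted to each
  of the infinitely many recurrences in \<open>y\<close> of the stretch containing it. Each transplant produces
  two preimages that agree up to the recurrence and differ within it, so the number \<open>R T\<close> of left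
  halves of preimages would grow without bound, although \<open>y\<close> has finitely many preimages.
\<close>
lemma preimage_determined_by_block:
  assumes dt: "doubly_transitive Y y" and x: "x \<in> X" "\<pi> x = y" and x': "x' \<in> X" "\<pi> x' = y"
    and k: "magic_at y k" and eq: "block x k = block x' k" and q: "j0 + k - int r \<le> q"
  shows "x q = x' q"
proof (rule ccontr)
  assume ne: "x q \<noteq> x' q"
  let ?U = "int (length u)" and ?F = "fiber X \<pi> y"
  have yY: "y \<in> Y" using dt by (simp add: doubly_transitive_def)
  have fin: "finite ?F" using finite_fibers yY by (simp add: finite_to_one_def)
  obtain k' where k': "max k (q - j0 + 1) \<le> k'" "magic_at y k'"
    using doubly_transitive_recurrence(1)[OF dt y0] unfolding magic_at_def by blast
  define res where "res T x = (\<lambda>i. if i < T then x i else undefined)" for T :: int and x :: "int \<Rightarrow> 'a"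
  define R where "R T = card (res T ` ?F)" for T
  have "\<exists>T'. R T < R T'" for T
  proof -
    obtain t where t: "max 0 (T - (j0 + k)) \<le> t" "\<forall>i\<in>{a0 + k..<b0 + k'}. y (i + t) = y i"
      using doubly_transitive_recurrence(1)[OF dt yY] by blast
    have "magic_at y (k + t)"
      unfolding magic_at_def
    proof
      fix i assume "i \<in> {a0..<b0}"
      then show "y (i + (k + t)) = y0 i"
        using t(2)[rule_format, of "i + k"] k k'(1) by (auto simp: magic_at_def algebra_simps)
    qed
    moreover have "block x k \<in> blocks" using x k by (intro block_in_blocks) auto
    ultimately obtain f where f: "f \<in> X" "\<pi> f = y" "block f (k + t) = block x k"
      using preimage_through_block[OF yY] by metis
    obtain z where z: "z \<in> X" "\<pi> z = y" "\<And>i. i < j0 + k + t + ?U + int r \<Longrightarrow> z i = f i"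
      "\<And>i. j0 + k - int r \<le> i \<Longrightarrow> i < j0 + k' + ?U + int r \<Longrightarrow> z (i + t) = x i"
      using transplant[OF x(1), of k k' t f] k k' t f x(2) by auto
    obtain z' where z': "z' \<in> X" "\<pi> z' = y" "\<And>i. i < j0 + k + t + ?U + int r \<Longrightarrow> z' i = f i"
      "\<And>i. j0 + k - int r \<le> i \<Longrightarrow> i < j0 + k' + ?U + int r \<Longrightarrow> z' (i + t) = x' i"
      using transplant[OF x'(1), of k k' t f] k k' t f x'(2) eq by auto
    define T' where "T' = max T (q + t + 1)"
    have im: "res T ` ?F = res T ` (res T' ` ?F)"
      unfolding image_image by (rule image_cong) (auto simp: res_def T'_def fun_eq_iff)
    have "\<not> inj_on (res T) (res T' ` ?F)"
    proof
      assume inj: "inj_on (res T) (res T' ` ?F)"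
      have "res T (res T' z) = res T (res T' z')"
        using t(1) z(3) z'(3) by (auto simp: res_def T'_def fun_eq_iff)
      moreover have "z \<in> ?F" "z' \<in> ?F" using z(1,2) z'(1,2) by (auto simp: fiber_def)
      ultimately have "res T' z = res T' z'" by (rule inj_onD[OF inj _ imageI imageI])
      then have "res T' z (q + t) = res T' z' (q + t)" by simp
      moreover have "q + t < T'" by (simp add: T'_def)
      ultimately show False using z(4)[OF q] z'(4)[OF q] ne k'(1) by (simp add: res_def)
    qed
    then have "R T \<noteq> R T'"
      unfolding R_def im using eq_card_imp_inj_on[of "res T' ` ?F" "res T"] fin by auto
    moreover have "R T \<le> R T'" unfolding R_def im using fin by (intro card_image_le) auto
    ultimately show ?thesis by (intro exI[of _ T']) simp
  qed
  moreover have "R T < Suc (card ?F)" for T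
    unfolding R_def using card_image_le[OF fin, of "res T"] by simp
  ultimately show False
    using ex_has_greatest_nat[of "\<lambda>_. True" 0 R "Suc (card ?F)"] by (metis linorder_not_less)
qed

text \<open>
  A position of the magic window so far to the left that the finitely many preimages already differ
  to the right of it turns \<open>x \<mapsto> block x k\<close> into a bijection from the fibre to the blocks.
\<close>
theorem card_fiber_doubly_transitive:
  assumes dt: "doubly_transitive Y y"
  shows "card (fiber X \<pi> y) = card blocks"
proof -
  let ?F = "fiber X \<pi> y"
  have yY: "y \<in> Y" using dt by (simp add: doubly_transitive_def)
  have fin: "finite ?F" using finite_fibers yY by (simp add: finite_to_one_def)
  \<comment> \<open>\<open>q0\<close> is a lower bound for positions at which the preimages can be told apart.\<close>
  define dpos where "dpos = (\<lambda>(x, x'). SOME q::int. (x q :: 'a) \<noteq> x' q)"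
  define q0 where "q0 = Min (insert 0 (dpos ` (?F \<times> ?F)))"
  have q0: "\<exists>q\<ge>q0. x q \<noteq> x' q" if "x \<in> ?F" "x' \<in> ?F" "x \<noteq> x'" for x x'
  proof (intro exI conjI)
    show "q0 \<le> dpos (x, x')" unfolding q0_def using fin that by (intro Min_le) auto
    show "x (dpos (x, x')) \<noteq> x' (dpos (x, x'))"
    proof -
      obtain p where "x p \<noteq> x' p" using \<open>x \<noteq> x'\<close> by blast
      then show ?thesis using someI[of "\<lambda>q. x q \<noteq> x' q" p] by (simp add: dpos_def)
    qed
  qed
  obtain k where k: "k \<le> q0 - j0" "magic_at y k"
    using doubly_transitive_recurrence(2)[OF dt y0] unfolding magic_at_def by blast
  have "bij_betw (\<lambda>x. block x k) ?F blocks"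
  proof (rule bij_betwI')
    fix x x' assume x: "x \<in> ?F" "x' \<in> ?F"
    show "block x k = block x' k \<longleftrightarrow> x = x'"
    proof
      assume eq: "block x k = block x' k"
      show "x = x'"
      proof (rule ccontr)
        assume "x \<noteq> x'"
        then obtain q where q: "q0 \<le> q" "x q \<noteq> x' q" using q0 x by blast
        then show False
          using preimage_determined_by_block[OF dt _ _ _ _ k(2) eq, of q] x k(1) by (auto simp: fiber_def)
      qed
    qed simp
  next
    fix x assume "x \<in> ?F"
    then show "block x k \<in> blocks" using k(2) block_in_blocks by (auto simp: fiber_def)
  next
    fix B assume "B \<in> blocks"
    then obtain x where "x \<in> X" "\<pi> x = y" "block x k = B"
      using preimage_through_block[OF yY k(2)] by metis
    then show "\<exists>x\<in>?F. B = block x k" by (auto simp: fiber_def)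
  qed
  then show ?thesis by (rule bij_betw_same_card)
qed

end

theorem card_fiber_doubly_transitive_constant:
  fixes X :: "(int \<Rightarrow> 'a::discrete_topology) set" and Y :: "(int \<Rightarrow> 'b::discrete_topology) set"
  assumes "sofic X" "irreducible_shift X" "factor_code X Y \<pi>" "finite_to_one X Y \<pi>" "X \<noteq> {}"
  obtains d where "\<And>y. doubly_transitive Y y \<Longrightarrow> card (fiber X \<pi> y) = d"
proof -
  obtain r where r: "block_radius X \<pi> r" using factor_code_block_radius[OF assms(3)] .
  obtain s where s: "synchronizing X s" "2 * r + 1 \<le> length s"
    using exists_long_synchronizing[OF assms(1,5)] by blast
  interpret synchronized_code X Y \<pi> r s
    using assms r s by unfold_locales auto
  obtain u where u: "forcing u"
    using exists_word_forcing_sync[OF assms(5)] unfolding forcing_def by blast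
  then obtain y j where "y \<in> Y" "occurs_at u y j" by (auto simp: forcing_def language_def)
  then have ex: "case (y, j, j, j + int (length u)) of (y, j, a, b) \<Rightarrow>
      y \<in> Y \<and> occurs_at u y j \<and> a \<le> j \<and> j + int (length u) \<le> b" by simp
  obtain p where p: "case p of (y, j, a, b) \<Rightarrow> y \<in> Y \<and> occurs_at u y j \<and> a \<le> j \<and> j + int (length u) \<le> b"
    and min: "\<And>p'. (case p' of (y, j, a, b) \<Rightarrow> y \<in> Y \<and> occurs_at u y j \<and> a \<le> j \<and> j + int (length u) \<le> b)
      \<Longrightarrow> (case p of (y, j, a, b) \<Rightarrow> card (blocks_over u y a b j))
        \<le> (case p' of (y, j, a, b) \<Rightarrow> card (blocks_over u y a b j))"
    using ex_has_least_nat[of "\<lambda>(y, j, a, b). y \<in> Y \<and> occurs_at u y j \<and> a \<le> j \<and> j + int (length u) \<le> b",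
        OF ex, of "\<lambda>(y, j, a, b). card (blocks_over u y a b j)"] by blast
  obtain y0 j0 a0 b0 where pp: "p = (y0, j0, a0, b0)" by (metis prod_cases4)
  interpret magic_word X Y \<pi> r s u y0 a0 b0 j0
  proof unfold_locales
    fix y a b j assume "y \<in> Y" "occurs_at u y j" "a \<le> j" "j + int (length u) \<le> b"
    then show "card (blocks_over u y0 a0 b0 j0) \<le> card (blocks_over u y a b j)"
      using min[of "(y, j, a, b)"] pp by simp
  qed (use u p pp in auto)
  show ?thesis using that card_fiber_doubly_transitive by blast
qed

section \<open>Ergodic measures\<close>

lemma invariant_probD:
  assumes "invariant_prob S T M"
  shows "prob_space M" "sets M = sets S" "space M = space S" "T \<in> measurable S S"
    "T \<in> measurable M M" "distr M M T = M"
proof -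
  show "prob_space M" and s: "sets M = sets S" and T: "T \<in> measurable S S"
    using assms by (auto simp: invariant_prob_def)
  show "space M = space S" using s by (rule sets_eq_imp_space_eq)
  show "T \<in> measurable M M" using T s by (metis measurable_cong_sets)
  have "distr M M T = distr M S T" using s by (intro distr_cong) auto
  then show "distr M M T = M" using assms by (simp add: invariant_prob_def)
qed

lemma AE_invariant_funpow:
  assumes inv: "invariant_prob S T M" and "AE x in M. P x"
  shows "AE x in M. P ((T ^^ n) x)"
proof (induction n)
  case (Suc n)
  note T = invariant_probD(5,6)[OF inv]
  have "AE x in distr M M T. P ((T ^^ n) x)" unfolding T(2) by (rule Suc)
  then have "AE x in M. P ((T ^^ n) (T x))" by (rule AE_distrD[OF T(1)])
  then show ?case by (simp add: funpow_swap1)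
qed (use assms in simp)

lemma funpow_measurable: "T \<in> measurable S S \<Longrightarrow> (T ^^ n) \<in> measurable S S"
  by (induction n) (auto intro: measurable_comp)

text \<open>
  The set of points that return to \<open>U\<close> infinitely often is strictly invariant and agrees with \<open>U\<close>
  almost everywhere, so that the definition of ergodicity applies to it.
\<close>
lemma ergodic_almost_invariant:
  assumes erg: "ergodic_prob S T M" and U: "U \<in> sets S" and ae: "AE x in M. T x \<in> U \<longleftrightarrow> x \<in> U"
  shows "measure M U = 0 \<or> measure M U = 1"
proof -
  have inv: "invariant_prob S T M" using erg by (simp add: ergodic_prob_def)
  note D = invariant_probD[OF inv]
  interpret prob_space M by (rule D(1))
  define E where "E = {x \<in> space S. \<forall>m. \<exists>n. m \<le> n \<and> (T ^^ n) x \<in> U}"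
  have Tn[measurable]: "(T ^^ n) \<in> measurable S S" for n by (rule funpow_measurable[OF D(4)])
  have [measurable]: "U \<in> sets S" by (rule U)
  have E: "E \<in> sets S" unfolding E_def by measurable
  have "T x \<in> E \<longleftrightarrow> x \<in> E" if x: "x \<in> space S" for x
  proof
    assume "T x \<in> E"
    then have *: "\<forall>m. \<exists>n\<ge>m. (T ^^ Suc n) x \<in> U" by (simp add: E_def funpow_swap1)
    show "x \<in> E" unfolding E_def
    proof (intro CollectI conjI allI x)
      fix m
      obtain n where "n \<ge> m" "(T ^^ Suc n) x \<in> U" using * by blast
      then show "\<exists>n\<ge>m. (T ^^ n) x \<in> U" by (intro exI[of _ "Suc n"]) simp
    qed
  next
    assume "x \<in> E"
    then have *: "\<And>m. \<exists>n\<ge>m. (T ^^ n) x \<in> U" by (auto simp: E_def)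
    show "T x \<in> E" unfolding E_def
    proof (intro CollectI conjI allI)
      show "T x \<in> space S" using x D(4) by (simp add: measurable_space)
      fix m
      obtain n where "n \<ge> Suc m" "(T ^^ n) x \<in> U" using * by blast
      moreover then obtain l where "n = Suc l" by (cases n) auto
      ultimately show "\<exists>n\<ge>m. (T ^^ n) (T x) \<in> U"
        by (intro exI[of _ l]) (simp add: funpow_swap1)
    qed
  qed
  moreover have "E \<subseteq> space S" by (auto simp: E_def)
  ultimately have "T -` E \<inter> space S = E" by auto
  then have 01: "measure M E = 0 \<or> measure M E = 1" using erg E by (simp add: ergodic_prob_def)
  have "AE x in M. (T ^^ n) x \<in> U \<longleftrightarrow> x \<in> U" for n
  proof (induction n)
    case (Suc n)
    have "AE x in M. (T ^^ n) (T x) \<in> U \<longleftrightarrow> T x \<in> U"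
      using AE_invariant_funpow[OF inv, of "\<lambda>x. (T ^^ n) x \<in> U \<longleftrightarrow> x \<in> U" 1] Suc by simp
    then show ?case using ae by eventually_elim (simp add: funpow_swap1)
  qed simp
  then have "AE x in M. \<forall>n. (T ^^ n) x \<in> U \<longleftrightarrow> x \<in> U" by (simp add: AE_all_countable)
  then have "AE x in M. x \<in> E \<longleftrightarrow> x \<in> U"
    using AE_space
  proof eventually_elim
    case (elim x)
    then show ?case by (auto simp: E_def D(3))
  qed
  then have "measure M E = measure M U"
    using E U D(2) by (intro measure_eq_AE) auto
  then show ?thesis using 01 by simp
qed

lemma (in finite_measure) AE_mem_iff_if_subset:
  assumes "A \<subseteq> B" "A \<in> sets M" "B \<in> sets M" "measure M A = measure M B"
  shows "AE x in M. x \<in> A \<longleftrightarrow> x \<in> B"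
proof -
  have "measure M (B - A) = 0" using assms by (simp add: finite_measure_Diff)
  then have "B - A \<in> null_sets M" using assms by (auto simp: null_sets_def emeasure_eq_measure)
  then have "AE x in M. x \<notin> B - A" by (rule AE_not_in)
  then show ?thesis using assms(1) by (auto elim: eventually_mono)
qed

text \<open>
  \<open>U\<close> and its preimage have the same measure, so an inclusion between them is an equality almost
  everywhere.
\<close>
lemma ergodic_monotone_set:
  assumes erg: "ergodic_prob S T M" and U: "U \<in> sets S"
    and mono: "T -` U \<inter> space S \<subseteq> U \<or> U \<subseteq> T -` U \<inter> space S"
  shows "measure M U = 0 \<or> measure M U = 1"
proof (rule ergodic_almost_invariant[OF erg U])
  have inv: "invariant_prob S T M" using erg by (simp add: ergodic_prob_def)
  note D = invariant_probD[OF inv]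
  interpret prob_space M by (rule D(1))
  let ?V = "T -` U \<inter> space S"
  have V: "?V \<in> sets M" "U \<in> sets M" using U D(2,4) measurable_sets by auto
  have "measure M U = measure (distr M M T) U" by (simp add: D(6))
  also have "\<dots> = measure M ?V" using D(5) V(2) by (simp add: measure_distr D(3))
  finally have "AE x in M. x \<in> ?V \<longleftrightarrow> x \<in> U"
    using mono AE_mem_iff_if_subset[of ?V U] AE_mem_iff_if_subset[of U ?V] V by (auto elim: eventually_mono)
  then show "AE x in M. T x \<in> U \<longleftrightarrow> x \<in> U"
    using AE_space by eventually_elim (simp add: D(3))
qed

text \<open>
  The density \<open>f\<close> of \<open>m\<close> is almost invariant, so \<open>{f > 1}\<close> has measure \<open>0\<close> or \<open>1\<close>. It cannot be \<open>1\<close>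
  because \<open>f\<close> has integral \<open>1\<close>. Hence \<open>m \<le> \<mu>\<close> on all sets, and passing to complements gives equality.
\<close>
lemma invariant_abs_cont_ergodic_eq:
  assumes m: "invariant_prob S T m" and erg: "ergodic_prob S T \<mu>"
    and T': "T' \<in> measurable S S" "\<And>x. x \<in> space S \<Longrightarrow> T' (T x) = x"
    and ac: "absolutely_continuous \<mu> m"
  shows "m = \<mu>"
proof -
  have inv: "invariant_prob S T \<mu>" using erg by (simp add: ergodic_prob_def)
  note D = invariant_probD[OF inv] and Dm = invariant_probD[OF m]
  interpret \<mu>: prob_space \<mu> by (rule D(1))
  interpret m: prob_space m by (rule Dm(1))
  have sets_eq: "sets m = sets \<mu>" using D(2) Dm(2) by simp
  define f where "f = RN_deriv \<mu> m"
  have f[measurable]: "f \<in> borel_measurable \<mu>" unfolding f_def by simp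
  have dens: "density \<mu> f = m" unfolding f_def by (rule \<mu>.density_RN_deriv[OF ac sets_eq])
  have dm: "distr m \<mu> T = m"
  proof -
    have "distr m \<mu> T = distr m m T" using sets_eq by (intro distr_cong) auto
    then show ?thesis by (simp add: Dm(6))
  qed
  have "AE x in \<mu>. RN_deriv (distr \<mu> \<mu> T) (distr m \<mu> T) (T x) = RN_deriv \<mu> m x"
  proof (rule \<mu>.RN_deriv_distr)
    show "T \<in> measurable \<mu> \<mu>" by (rule D(5))
    show "T' \<in> measurable \<mu> \<mu>" using T'(1) D(2) by (metis measurable_cong_sets)
  qed (use T'(2) D ac dm sets_eq in auto)
  then have fT: "AE x in \<mu>. f (T x) = f x" by (simp add: D(6) dm f_def)
  define U where "U = {x \<in> space \<mu>. 1 < f x}"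
  have U: "U \<in> sets \<mu>" unfolding U_def by measurable
  have "AE x in \<mu>. T x \<in> U \<longleftrightarrow> x \<in> U"
    using fT AE_space by eventually_elim (use D(5) in \<open>auto simp: U_def measurable_space\<close>)
  then have 01: "measure \<mu> U = 0 \<or> measure \<mu> U = 1"
    using U D(2) by (intro ergodic_almost_invariant[OF erg]) auto
  have int_f: "(\<integral>\<^sup>+x. f x \<partial>\<mu>) = 1"
  proof -
    have "(\<integral>\<^sup>+x. f x \<partial>\<mu>) = emeasure (density \<mu> f) (space \<mu>)"
      by (simp add: emeasure_density cong: nn_integral_cong)
    also have "\<dots> = 1" unfolding dens using m.emeasure_space_1 D(3) Dm(3) by simp
    finally show ?thesis .
  qed
  have "measure \<mu> U \<noteq> 1"
  proof
    assume "measure \<mu> U = 1"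
    then have gt: "AE x in \<mu>. 1 < f x"
      using \<mu>.AE_prob_1[of U] U by (auto simp: U_def elim: eventually_mono)
    have "\<not> (AE x in \<mu>. f x \<le> 1)"
    proof
      assume "AE x in \<mu>. f x \<le> 1"
      then have "AE x in \<mu>. False" using gt by eventually_elim auto
      then show False by simp
    qed
    then have "(\<integral>\<^sup>+x. 1 \<partial>\<mu>) < (\<integral>\<^sup>+x. f x \<partial>\<mu>)"
      using gt by (intro nn_integral_less) (auto simp: \<mu>.emeasure_space_1 elim: eventually_mono)
    then show False using int_f by (simp add: \<mu>.emeasure_space_1)
  qed
  then have "measure \<mu> U = 0" using 01 by blast
  then have "U \<in> null_sets \<mu>" using U by (auto simp: null_sets_def \<mu>.emeasure_eq_measure)
  then have le1: "AE x in \<mu>. f x \<le> 1"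
    using AE_not_in AE_space by (force simp: U_def elim: eventually_elim2)
  have le: "measure m A \<le> measure \<mu> A" if A: "A \<in> sets \<mu>" for A
  proof -
    have "emeasure m A = (\<integral>\<^sup>+x. f x * indicator A x \<partial>\<mu>)"
      using A by (subst dens[symmetric]) (simp add: emeasure_density)
    also have "\<dots> \<le> (\<integral>\<^sup>+x. indicator A x \<partial>\<mu>)"
      using le1 by (intro nn_integral_mono_AE) (auto elim!: eventually_mono split: split_indicator)
    also have "\<dots> = emeasure \<mu> A" using A by simp
    finally show ?thesis by (simp add: m.emeasure_eq_measure \<mu>.emeasure_eq_measure)
  qed
  show ?thesis
  proof (rule measure_eqI[OF sets_eq])
    fix A assume A: "A \<in> sets m"
    then have "space \<mu> - A \<in> sets \<mu>" using sets_eq by auto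
    then have "measure m (space m - A) \<le> measure \<mu> (space \<mu> - A)"
      using le[of "space \<mu> - A"] D(3) Dm(3) by simp
    then have "measure m A = measure \<mu> A"
      using le[of A] A sets_eq by (simp add: m.prob_compl \<mu>.prob_compl)
    then show "emeasure m A = emeasure \<mu> A"
      by (simp add: m.emeasure_eq_measure \<mu>.emeasure_eq_measure)
  qed
qed

text \<open>
  By the preceding lemma \<open>\<mu>\<close> is not absolutely continuous with respect to \<open>m\<close>, so some null set of \<open>m\<close> has positive measure for \<open>\<mu>\<close>. The
  points that ever enter it form a set which is null for \<open>m\<close> and, by ergodicity, full for \<open>\<mu>\<close>.
\<close>
lemma ergodic_mutually_singular:
  assumes \<mu>: "ergodic_prob S T \<mu>" and m: "ergodic_prob S T m" and ne: "\<mu> \<noteq> m"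
    and T': "T' \<in> measurable S S" "\<And>x. x \<in> space S \<Longrightarrow> T' (T x) = x"
  obtains E where "E \<in> sets S" "measure \<mu> E = 1" "measure m E = 0"
proof -
  have inv: "invariant_prob S T \<mu>" "invariant_prob S T m"
    using \<mu> m by (simp_all add: ergodic_prob_def)
  note D = invariant_probD[OF inv(1)] and Dm = invariant_probD[OF inv(2)]
  interpret \<mu>: prob_space \<mu> by (rule D(1))
  interpret m: prob_space m by (rule Dm(1))
  have "\<not> absolutely_continuous m \<mu>"
    using invariant_abs_cont_ergodic_eq[OF inv(1) m T'] ne by blast
  then obtain E0 where E0: "E0 \<in> null_sets m" "E0 \<notin> null_sets \<mu>"
    by (auto simp: absolutely_continuous_def)
  then have E0S: "E0 \<in> sets S" "E0 \<in> sets \<mu>" using D(2) Dm(2) by auto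
  then have pos: "0 < measure \<mu> E0"
    using E0(2) by (auto simp: null_sets_def \<mu>.emeasure_eq_measure zero_less_measure_iff)
  define E where "E = (\<Union>n. (T ^^ n) -` E0 \<inter> space S)"
  have E: "E \<in> sets S"
    unfolding E_def using funpow_measurable[OF D(4)] E0S(1) by (intro sets.countable_UN) (auto intro: measurable_sets)
  have "T -` E \<inter> space S \<subseteq> E"
  proof
    fix x assume "x \<in> T -` E \<inter> space S"
    then obtain n where "(T ^^ n) (T x) \<in> E0" "x \<in> space S" by (auto simp: E_def)
    then have "x \<in> (T ^^ Suc n) -` E0 \<inter> space S" by (simp add: funpow_swap1)
    then show "x \<in> E" unfolding E_def by blast
  qed
  then have "measure \<mu> E = 0 \<or> measure \<mu> E = 1" using ergodic_monotone_set[OF \<mu> E] by blast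
  moreover have "E0 \<subseteq> E"
  proof -
    have "E0 = (T ^^ 0) -` E0 \<inter> space S" using sets.sets_into_space[OF E0S(1)] by auto
    then show ?thesis unfolding E_def by blast
  qed
  then have "measure \<mu> E0 \<le> measure \<mu> E" using E D(2) by (intro \<mu>.finite_measure_mono) auto
  ultimately have 1: "measure \<mu> E = 1" using pos by linarith
  have "AE x in m. (T ^^ n) x \<notin> E0" for n
    by (rule AE_invariant_funpow[OF inv(2) AE_not_in[OF E0(1)]])
  then have "AE x in m. \<forall>n. (T ^^ n) x \<notin> E0" by (simp add: AE_all_countable)
  then have "AE x in m. x \<notin> E" by (auto simp: E_def elim: eventually_mono)
  then have "measure m E = 0" using E Dm(2) by (simp add: m.prob_eq_0)
  then show ?thesis using that E 1 by blast
qed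

text \<open>
  One set of the algebra serves finitely many measures at once. For a union, finitely many of the
  sets suffice up to \<open>e / 2\<close>, and the other half of the error is shared among their approximations.
\<close>
lemma approximate_by_algebra:
  fixes M :: "'j \<Rightarrow> 'c measure"
  assumes alg: "algebra \<Omega> \<A>" and J: "finite J"
    and M: "\<And>j. j \<in> J \<Longrightarrow> finite_measure (M j)" "\<And>j. j \<in> J \<Longrightarrow> sets (M j) = sigma_sets \<Omega> \<A>"
    and E: "E \<in> sigma_sets \<Omega> \<A>" and e: "0 < (e::real)"
  shows "\<exists>C\<in>\<A>. \<forall>j\<in>J. measure (M j) ((E - C) \<union> (C - E)) < e"
  using E e
proof (induction arbitrary: e)
  case (Basic a)
  then show ?case by (intro bexI[of _ a]) auto
next
  case Empty
  interpret algebra \<Omega> \<A> by (rule alg)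
  show ?case using Empty by (intro bexI[of _ "{}"]) auto
next
  case (Compl a)
  interpret algebra \<Omega> \<A> by (rule alg)
  obtain C where C: "C \<in> \<A>" "\<forall>j\<in>J. measure (M j) ((a - C) \<union> (C - a)) < e"
    using Compl.IH[OF Compl.prems] by blast
  have "a \<subseteq> \<Omega>" using sigma_sets_into_sp[OF space_closed Compl.hyps] .
  moreover have "C \<subseteq> \<Omega>" using C(1) space_closed by blast
  ultimately have "((\<Omega> - a) - (\<Omega> - C)) \<union> ((\<Omega> - C) - (\<Omega> - a)) = (a - C) \<union> (C - a)" by auto
  then show ?case using C by (intro bexI[of _ "\<Omega> - C"]) auto
next
  case (Union a)
  interpret algebra \<Omega> \<A> by (rule alg)
  have "\<forall>\<^sub>F n in sequentially. measure (M j) ((\<Union>i. a i) - (\<Union>i<n. a i)) < e / 2" if j: "j \<in> J" for j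
  proof -
    interpret Mj: finite_measure "M j" by (rule M(1)[OF j])
    have a: "a i \<in> sets (M j)" for i using Union.hyps M(2)[OF j] by simp
    have "(\<lambda>n. measure (M j) (\<Union>i<n. a i)) \<longlonglongrightarrow> measure (M j) (\<Union>n. \<Union>i<n. a i)"
      by (intro Mj.finite_Lim_measure_incseq) (use a in \<open>auto simp: incseq_def intro: less_le_trans\<close>)
    moreover have "(\<Union>n. \<Union>i<n. a i) = (\<Union>i. a i)" by auto
    ultimately have "(\<lambda>n. measure (M j) (\<Union>i. a i) - measure (M j) (\<Union>i<n. a i)) \<longlonglongrightarrow>
        measure (M j) (\<Union>i. a i) - measure (M j) (\<Union>i. a i)"
      by (intro tendsto_diff tendsto_const) simp
    then have "\<forall>\<^sub>F n in sequentially. measure (M j) (\<Union>i. a i) - measure (M j) (\<Union>i<n. a i) < e / 2"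
      using Union.prems by (intro order_tendstoD(2)) auto
    moreover have "measure (M j) ((\<Union>i. a i) - (\<Union>i<n. a i)) =
        measure (M j) (\<Union>i. a i) - measure (M j) (\<Union>i<n. a i)" for n
      using a by (intro Mj.finite_measure_Diff) auto
    ultimately show ?thesis by simp
  qed
  then have "\<forall>\<^sub>F n in sequentially. \<forall>j\<in>J. measure (M j) ((\<Union>i. a i) - (\<Union>i<n. a i)) < e / 2"
    using J by (simp add: eventually_ball_finite)
  then obtain N where N: "\<And>j. j \<in> J \<Longrightarrow> measure (M j) ((\<Union>i. a i) - (\<Union>i<N. a i)) < e / 2"
    by (auto simp: eventually_sequentially)
  define d where "d = e / (2 * real (N + 1))"
  have d: "0 < d" using Union.prems by (simp add: d_def)
  have "\<exists>C\<in>\<A>. \<forall>j\<in>J. measure (M j) ((a i - C) \<union> (C - a i)) < d" for i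
    using Union.IH[OF d] .
  then obtain C where C: "\<And>i. C i \<in> \<A>" "\<And>i j. j \<in> J \<Longrightarrow> measure (M j) ((a i - C i) \<union> (C i - a i)) < d"
    by metis
  have "measure (M j) (((\<Union>i. a i) - (\<Union>i<N. C i)) \<union> ((\<Union>i<N. C i) - (\<Union>i. a i))) < e" if j: "j \<in> J" for j
  proof -
    interpret Mj: finite_measure "M j" by (rule M(1)[OF j])
    have a: "a i \<in> sets (M j)" "C i \<in> sets (M j)" for i
      using Union.hyps C(1) M(2)[OF j] by auto
    let ?D = "\<lambda>i. (a i - C i) \<union> (C i - a i)"
    have "measure (M j) (((\<Union>i. a i) - (\<Union>i<N. C i)) \<union> ((\<Union>i<N. C i) - (\<Union>i. a i)))
        \<le> measure (M j) (((\<Union>i. a i) - (\<Union>i<N. a i)) \<union> (\<Union>i<N. ?D i))"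
      by (rule Mj.finite_measure_mono) (use a in \<open>auto intro!: sets.Un sets.Diff sets.countable_UN\<close>)
    also have "\<dots> \<le> measure (M j) ((\<Union>i. a i) - (\<Union>i<N. a i)) + measure (M j) (\<Union>i<N. ?D i)"
      using a by (intro measure_Un_le) auto
    also have "measure (M j) (\<Union>i<N. ?D i) \<le> (\<Sum>i<N. measure (M j) (?D i))"
      using a by (intro measure_UNION_le) auto
    also have "\<dots> \<le> (\<Sum>i<N. d)" using C(2)[OF j] by (intro sum_mono less_imp_le)
    also have "(\<Sum>i<N. d) \<le> e / 2"
      using Union.prems by (simp add: d_def field_simps)
    finally show ?thesis using N[OF j] by simp
  qed
  moreover have "(\<Union>i<N. C i) \<in> \<A>" using C(1) by (intro finite_UN) auto
  ultimately show ?case by blast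
qed

section \<open>Borel sets of shift spaces and doubly transitive points\<close>

lemma space_borel_on [simp]: "space (borel_on X) = X"
  by (simp add: borel_on_def space_restrict_space)

lemma open_Int_borel_on: "open U \<Longrightarrow> X \<inter> U \<in> sets (borel_on X)"
  by (auto simp: borel_on_def sets_restrict_space)

lemma closed_subset_borel_on:
  assumes "closed C" "C \<subseteq> X"
  shows "C \<in> sets (borel_on X)"
proof -
  have "C = X \<inter> C" using assms(2) by auto
  then show ?thesis using assms(1) by (auto simp: borel_on_def sets_restrict_space)
qed

lemma continuous_measurable_borel_on:
  assumes "continuous_on X f" "f ` X \<subseteq> Y"
  shows "f \<in> measurable (borel_on X) (borel_on Y)"
  unfolding borel_on_def
  by (rule measurable_restrict_space2)
     (use assms borel_measurable_continuous_on_restrict in \<open>auto simp: space_restrict_space\<close>)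

lemma translate_measurable:
  assumes "shift_space X"
  shows "translate t \<in> measurable (borel_on X) (borel_on X)"
proof (rule continuous_measurable_borel_on)
  have "continuous_on UNIV (translate t :: (int \<Rightarrow> 'a) \<Rightarrow> int \<Rightarrow> 'a)"
    unfolding translate_def by (intro continuous_on_coordinatewise_then_product continuous_on_product_coordinates)
  then show "continuous_on X (translate t)" by (rule continuous_on_subset) simp
  show "translate t ` X \<subseteq> X" using shift_space_translate_in[OF assms] by blast
qed

lemma countable_language:
  fixes X :: "(int \<Rightarrow> 'a::discrete_topology) set"
  assumes "shift_space X"
  shows "countable (language X)"
proof -
  obtain A where "finite A" "language X \<subseteq> lists A" using finite_words[OF assms] .
  then show ?thesis by (meson countable_finite countable_lists countable_subset)
qed

lemma compact_imp_closed_sequence_space: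
  fixes K :: "(int \<Rightarrow> 'b::t2_space) set"
  assumes "compact K"
  shows "closed K"
proof -
  have "Hausdorff_space (euclidean :: 'b topology)"
    unfolding Hausdorff_space_def disjnt_def using hausdorff by (simp, blast)
  then have "Hausdorff_space (product_topology (\<lambda>_::int. euclidean :: 'b topology) UNIV)"
    by (simp add: Hausdorff_space_product_topology)
  then have "Hausdorff_space (euclidean :: (int \<Rightarrow> 'b) topology)"
    by (simp add: euclidean_product_topology)
  then show ?thesis using compactin_imp_closedin[of euclidean K] assms by simp
qed

text \<open>
  Closedness in the ambient space replaces relative topology: for closed \<open>X\<close> these are the subsets
  of \<open>X\<close> that are open and closed in \<open>X\<close>.
\<close>
definition clopen_subsets :: "'c::topological_space set \<Rightarrow> 'c set set" where
  "clopen_subsets X = {C. C \<subseteq> X \<and> closed C \<and> closed (X - C)}"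

lemma algebra_clopen_subsets:
  assumes "closed X"
  shows "algebra X (clopen_subsets X)"
  unfolding algebra_iff_Un
proof (intro conjI ballI)
  show "clopen_subsets X \<subseteq> Pow X" "{} \<in> clopen_subsets X"
    using assms by (auto simp: clopen_subsets_def)
  fix a assume a: "a \<in> clopen_subsets X"
  then have "X - (X - a) = a" by (auto simp: clopen_subsets_def)
  then show "X - a \<in> clopen_subsets X" using a by (auto simp: clopen_subsets_def)
  fix b assume b: "b \<in> clopen_subsets X"
  have "X - (a \<union> b) = (X - a) \<inter> (X - b)" by auto
  then show "a \<union> b \<in> clopen_subsets X" using a b by (auto simp: clopen_subsets_def)
qed

text \<open>
  A relatively open set is a union of cylinders, and there are only countably many cylinders because
  the language is countable. The ambient space of sequences over an arbitrary alphabet need not be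
  second countable.
\<close>
lemma sets_borel_on_clopen:
  fixes X :: "(int \<Rightarrow> 'a::discrete_topology) set"
  assumes X: "shift_space X"
  shows "sets (borel_on X) = sigma_sets X (clopen_subsets X)"
proof (rule antisym)
  have cl: "closed X" using X by (simp add: shift_space_def)
  have sub: "clopen_subsets X \<subseteq> Pow X" by (auto simp: clopen_subsets_def)
  show "sigma_sets X (clopen_subsets X) \<subseteq> sets (borel_on X)"
    using sets.sigma_sets_subset[of "clopen_subsets X" "borel_on X"]
    by (auto simp: clopen_subsets_def intro: closed_subset_borel_on)
  have cyl: "X \<inter> {z. occurs_at w z i} \<in> clopen_subsets X" for w i
  proof -
    have "X - (X \<inter> {z. occurs_at w z i}) = X \<inter> - {z. occurs_at w z i}" by auto
    then show ?thesis
      using cl closed_occurs_at[of w i] open_occurs_at[of w i] unfolding clopen_subsets_def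
      by (auto intro!: closed_Int simp del: Diff_Int2)
  qed
  have "(\<lambda>x. x) \<in> borel_measurable (sigma X (clopen_subsets X))"
  proof (rule borel_measurableI)
    fix U :: "(int \<Rightarrow> 'a) set" assume U: "open U"
    let ?P = "{(w, n::nat). w \<in> language X \<and> X \<inter> {z. occurs_at w z (- int n)} \<subseteq> U}"
    have "X \<inter> U = (\<Union>(w, n)\<in>?P. X \<inter> {z. occurs_at w z (- int n)})"
    proof (intro equalityI subsetI)
      fix x assume x: "x \<in> X \<inter> U"
      then obtain n :: nat where n: "\<And>z. (\<forall>i\<in>{- int n..int n}. z i = x i) \<Longrightarrow> z \<in> U"
        using open_contains_cylinder[OF U, of x] by auto
      let ?w = "window x (- int n) (2 * n + 1)"
      have "X \<inter> {z. occurs_at ?w z (- int n)} \<subseteq> U"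
        by (auto simp: occurs_at_iff_window window_eq_same_iff intro!: n)
      then have "(?w, n) \<in> ?P" using x by (simp add: window_in_language)
      then show "x \<in> (\<Union>(w, n)\<in>?P. X \<inter> {z. occurs_at w z (- int n)})" using x by force
    qed auto
    moreover have "countable ?P"
      by (rule countable_subset[of _ "language X \<times> UNIV"]) (auto simp: countable_language[OF X])
    then have "(\<Union>(w, n)\<in>?P. X \<inter> {z. occurs_at w z (- int n)}) \<in> sets (sigma X (clopen_subsets X))"
      by (rule sets.countable_UN') (use cyl sub in auto)
    ultimately have "X \<inter> U \<in> sets (sigma X (clopen_subsets X))" by (simp only:)
    then show "(\<lambda>x. x) -` U \<inter> space (sigma X (clopen_subsets X)) \<in> sets (sigma X (clopen_subsets X))"
      using sub by (simp add: Int_commute)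
  qed
  from measurable_sets[OF this]
  have "X \<inter> B \<in> sigma_sets X (clopen_subsets X)" if "B \<in> sets borel" for B :: "(int \<Rightarrow> 'a) set"
    using that sub by (simp add: Int_commute)
  then show "sets (borel_on X) \<subseteq> sigma_sets X (clopen_subsets X)"
    by (auto simp: borel_on_def sets_restrict_space)
qed

text \<open>
  For a word \<open>w\<close>, the points that show \<open>w\<close> somewhere to the right (or left) of \<open>N\<close> form a set that is
  monotone under the shift; it has positive measure by full support, hence measure \<open>1\<close>. There are
  countably many pairs of \<open>w\<close> and \<open>N\<close>.
\<close>
lemma AE_doubly_transitive:
  fixes Y :: "(int \<Rightarrow> 'b::discrete_topology) set"
  assumes Y: "shift_space Y" and erg: "ergodic_measure Y \<nu>" and supp: "fully_supported Y \<nu>"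
  shows "AE y in \<nu>. doubly_transitive Y y"
proof -
  have erg': "ergodic_prob (borel_on Y) shift \<nu>" using erg by (simp add: ergodic_measure_def)
  then have inv: "invariant_prob (borel_on Y) shift \<nu>" by (simp add: ergodic_prob_def)
  note D = invariant_probD[OF inv]
  interpret prob_space \<nu> by (rule D(1))
  have one: "AE y in \<nu>. \<exists>i\<in>I. occurs_at w y i"
    if w: "w \<in> language Y" and I: "I = {N..} \<or> I = {..N}" for w I and N :: int
  proof -
    define V where "V = Y \<inter> (\<Union>i\<in>I. {z. occurs_at w z i})"
    have V: "V \<in> sets (borel_on Y)"
      unfolding V_def by (intro open_Int_borel_on open_UN ballI open_occurs_at)
    have "N \<in> I" using I by auto
    obtain y where "y \<in> Y" "occurs_at w y N" using language_at[OF Y w] .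
    then have "0 < measure \<nu> ({z. occurs_at w z N} \<inter> Y)"
      using supp open_occurs_at[of w N] unfolding fully_supported_def by blast
    also have "\<dots> \<le> measure \<nu> V"
      using V D(2) \<open>N \<in> I\<close> by (intro finite_measure_mono) (auto simp: V_def)
    finally have pos: "0 < measure \<nu> V" .
    have shV: "shift y \<in> V \<longleftrightarrow> (\<exists>i\<in>I. occurs_at w y (i + 1))" if "y \<in> Y" for y
      using that shift_space_translate_in[OF Y that, of 1]
      by (auto simp: V_def shift_eq_translate occurs_at_translate)
    have "shift -` V \<inter> Y \<subseteq> V \<or> V \<subseteq> shift -` V \<inter> Y"
      using I
    proof
      assume "I = {N..}"
      then have "shift -` V \<inter> Y \<subseteq> V" using shV by (force simp: V_def)
      then show ?thesis by blast
    next
      assume I: "I = {..N}"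
      have "V \<subseteq> shift -` V \<inter> Y"
      proof
        fix y assume "y \<in> V"
        then obtain i where i: "y \<in> Y" "i \<le> N" "occurs_at w y i" by (auto simp: V_def I)
        then have "\<exists>i\<in>I. occurs_at w y (i + 1)" by (intro bexI[of _ "i - 1"]) (auto simp: I)
        then show "y \<in> shift -` V \<inter> Y" using shV i(1) by blast
      qed
      then show ?thesis by blast
    qed
    then have "measure \<nu> V = 1" using ergodic_monotone_set[OF erg' V] pos by auto
    then have "AE y in \<nu>. y \<in> V" using V D(2) by (intro AE_prob_1) auto
    then show ?thesis by (auto simp: V_def elim: eventually_mono)
  qed
  have "AE y in \<nu>. \<forall>w\<in>language Y. \<forall>N. (\<exists>i\<in>{N..}. occurs_at w y i) \<and> (\<exists>i\<in>{..N}. occurs_at w y i)"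
    using one by (simp add: AE_ball_countable countable_language[OF Y] AE_all_countable AE_conj_iff)
  then show ?thesis
    using AE_space
    by eventually_elim (auto simp: doubly_transitive_def D(3) Bex_def)
qed

section \<open>Degree joinings and lifts of ergodic measures\<close>

lemma margin_ergodic:
  assumes X: "shift_space X" and erg: "ergodic_prob (borel_power X n) (diagonal_shift n) \<Lambda>" and i: "i \<in> {1..n}"
  shows "ergodic_measure X (margin X i \<Lambda>)"
proof -
  have inv: "invariant_prob (borel_power X n) (diagonal_shift n) \<Lambda>" using erg by (simp add: ergodic_prob_def)
  note D = invariant_probD[OF inv]
  interpret prob_space \<Lambda> by (rule D(1))
  have p0: "(\<lambda>z. z i) \<in> measurable (borel_power X n) (borel_on X)"
    unfolding borel_power_def using i by measurable
  then have p: "(\<lambda>z. z i) \<in> measurable \<Lambda> (borel_on X)" using D(2) by (metis measurable_cong_sets)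
  have sh: "shift \<in> measurable (borel_on X) (borel_on X)"
    unfolding shift_eq_translate by (rule translate_measurable[OF X])
  have comm: "diagonal_shift n z i = shift (z i)" for z
    using i by (simp add: diagonal_shift_def)
  have "distr (margin X i \<Lambda>) (borel_on X) shift = distr \<Lambda> (borel_on X) (\<lambda>z. shift (z i))"
    unfolding margin_def by (subst distr_distr[OF sh p]) (simp add: o_def)
  also have "\<dots> = distr (distr \<Lambda> \<Lambda> (diagonal_shift n)) (borel_on X) (\<lambda>z. z i)"
    by (subst distr_distr[OF p D(5)]) (simp add: o_def comm)
  also have "\<dots> = margin X i \<Lambda>" by (simp add: D(6) margin_def)
  finally have "invariant_prob (borel_on X) shift (margin X i \<Lambda>)"
    using sh prob_space_distr[OF p] by (simp add: invariant_prob_def margin_def)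
  moreover have "measure (margin X i \<Lambda>) E = 0 \<or> measure (margin X i \<Lambda>) E = 1"
    if E: "E \<in> sets (borel_on X)" "shift -` E \<inter> space (borel_on X) = E" for E
  proof -
    let ?F = "(\<lambda>z. z i) -` E \<inter> space (borel_power X n)"
    have F: "?F \<in> sets (borel_power X n)" using p0 E(1) by (rule measurable_sets)
    have sp: "z i \<in> X" "diagonal_shift n z \<in> space (borel_power X n)" if "z \<in> space (borel_power X n)" for z
      using that measurable_space[OF p0 that] measurable_space[OF D(4) that] by simp_all
    have "shift x \<in> E \<longleftrightarrow> x \<in> E" if "x \<in> X" for x
      using E(2) that unfolding space_borel_on by blast
    then have "diagonal_shift n -` ?F \<inter> space (borel_power X n) = ?F"
      using sp by (auto simp: comm)
    then have "measure \<Lambda> ?F = 0 \<or> measure \<Lambda> ?F = 1" using erg F by (simp add: ergodic_prob_def)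
    then show ?thesis using p E(1) by (simp add: margin_def measure_distr D(3))
  qed
  ultimately show ?thesis by (simp add: ergodic_measure_def ergodic_prob_def)
qed

text \<open>
  Any measure over \<open>\<nu>\<close> gives \<open>C\<close> at most the measure \<open>\<nu> (\<pi> ` C)\<close>. The joining computes this number as
  the probability that the fibre of the common image meets \<open>C\<close>, and the fibre consists of
  coordinates \<open>z i\<close>. Closedness of \<open>C\<close>, hence compactness, ensures that \<open>\<pi> ` C\<close> is measurable.
\<close>
lemma measure_le_sum_margins:
  fixes X :: "(int \<Rightarrow> 'a::discrete_topology) set" and Y :: "(int \<Rightarrow> 'b::discrete_topology) set"
  assumes \<pi>: "factor_code X Y \<pi>" and i0: "i0 \<in> I" and I: "finite I"
    and \<Lambda>: "prob_space \<Lambda>" "\<And>i. i \<in> I \<Longrightarrow> (\<lambda>z. z i) \<in> measurable \<Lambda> (borel_on X)"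
    and over: "distr (margin X i0 \<Lambda>) (borel_on Y) \<pi> = \<nu>"
    and fib: "AE z in \<Lambda>. fiber X \<pi> (\<pi> (z i0)) \<subseteq> z ` I"
    and \<mu>: "prob_space \<mu>" "sets \<mu> = sets (borel_on X)" "distr \<mu> (borel_on Y) \<pi> = \<nu>"
    and C: "closed C" "C \<subseteq> X"
  shows "measure \<mu> C \<le> (\<Sum>i\<in>I. measure (margin X i \<Lambda>) C)"
proof -
  have X: "shift_space X" and cont: "continuous_on X \<pi>" and surj: "\<pi> ` X = Y"
    using \<pi> by (auto simp: factor_code_def)
  interpret \<Lambda>: prob_space \<Lambda> by (rule \<Lambda>(1))
  interpret \<mu>: prob_space \<mu> by (rule \<mu>(1))
  have m\<pi>: "\<pi> \<in> measurable (borel_on X) (borel_on Y)"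
    using cont surj by (intro continuous_measurable_borel_on) auto
  then have m\<pi>': "\<pi> \<in> measurable \<mu> (borel_on Y)" using \<mu>(2) by (metis measurable_cong_sets)
  have sp: "space \<mu> = X" using sets_eq_imp_space_eq[OF \<mu>(2)] by simp
  have Cm: "C \<in> sets (borel_on X)" using C by (rule closed_subset_borel_on)
  have "compact C" using compact_Int_closed[OF compact_shift_space[OF X] C(1)] C(2) by (simp add: Int_absorb1)
  then have "compact (\<pi> ` C)" using cont C(2) by (meson compact_continuous_image continuous_on_subset)
  then have "closed (\<pi> ` C)" by (rule compact_imp_closed_sequence_space)
  moreover have "\<pi> ` C \<subseteq> Y" using C(2) surj by blast
  ultimately have \<pi>C: "\<pi> ` C \<in> sets (borel_on Y)" by (rule closed_subset_borel_on)
  have "measure \<mu> C \<le> measure \<mu> (\<pi> -` (\<pi> ` C) \<inter> space \<mu>)"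
    using measurable_sets[OF m\<pi>' \<pi>C] C(2) sp by (intro \<mu>.finite_measure_mono) auto
  also have "\<dots> = measure \<nu> (\<pi> ` C)" unfolding \<mu>(3)[symmetric] using m\<pi>' \<pi>C by (simp add: measure_distr)
  also have "\<dots> = measure \<Lambda> ((\<lambda>z. \<pi> (z i0)) -` (\<pi> ` C) \<inter> space \<Lambda>)"
    unfolding over[symmetric] margin_def distr_distr[OF m\<pi> \<Lambda>(2)[OF i0]]
    using measurable_comp[OF \<Lambda>(2)[OF i0] m\<pi>] \<pi>C by (simp add: measure_distr o_def)
  also have "\<dots> \<le> measure \<Lambda> (\<Union>i\<in>I. (\<lambda>z. z i) -` C \<inter> space \<Lambda>)"
  proof (rule \<Lambda>.finite_measure_mono_AE)
    show "AE z in \<Lambda>. z \<in> (\<lambda>z. \<pi> (z i0)) -` (\<pi> ` C) \<inter> space \<Lambda> \<longrightarrow>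
        z \<in> (\<Union>i\<in>I. (\<lambda>z. z i) -` C \<inter> space \<Lambda>)"
      using fib
    proof eventually_elim
      case (elim z)
      show ?case
      proof
        assume "z \<in> (\<lambda>z. \<pi> (z i0)) -` (\<pi> ` C) \<inter> space \<Lambda>"
        then obtain c where c: "c \<in> C" "\<pi> c = \<pi> (z i0)" "z \<in> space \<Lambda>" by auto
        then have "c \<in> z ` I" using elim C(2) by (auto simp: fiber_def)
        then show "z \<in> (\<Union>i\<in>I. (\<lambda>z. z i) -` C \<inter> space \<Lambda>)" using c by auto
      qed
    qed
    show "(\<Union>i\<in>I. (\<lambda>z. z i) -` C \<inter> space \<Lambda>) \<in> sets \<Lambda>"
      using I \<Lambda>(2) Cm by (intro sets.finite_UN) (auto intro: measurable_sets)
  qed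
  also have "\<dots> \<le> (\<Sum>i\<in>I. measure \<Lambda> ((\<lambda>z. z i) -` C \<inter> space \<Lambda>))"
    using I \<Lambda>(2) Cm by (intro measure_UNION_le) (auto intro: measurable_sets)
  also have "\<dots> = (\<Sum>i\<in>I. measure (margin X i \<Lambda>) C)"
    using \<Lambda>(2) Cm by (intro sum.cong) (simp_all add: margin_def measure_distr)
  finally show ?thesis .
qed

text \<open>
  If \<open>\<mu>\<close> differed from all \<open>m i\<close>, mutual singularity would provide a Borel set of full measure for \<open>\<mu>\<close>
  and null for all \<open>m i\<close>. A clopen set approximating it violates the inequality.
\<close>
lemma ergodic_dominated_by_finite_sum:
  fixes X :: "(int \<Rightarrow> 'a::discrete_topology) set"
  assumes X: "shift_space X" and \<mu>: "ergodic_measure X \<mu>"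
    and I: "finite I" and m: "\<And>i. i \<in> I \<Longrightarrow> ergodic_measure X (m i)"
    and le: "\<And>C. closed C \<Longrightarrow> C \<subseteq> X \<Longrightarrow> measure \<mu> C \<le> (\<Sum>i\<in>I. measure (m i) C)"
  shows "\<exists>i\<in>I. \<mu> = m i"
proof (rule ccontr)
  assume "\<not> (\<exists>i\<in>I. \<mu> = m i)"
  then have ne: "\<mu> \<noteq> m i" if "i \<in> I" for i using that by blast
  let ?S = "borel_on X"
  have inv_\<mu>: "invariant_prob ?S shift \<mu>" using \<mu> by (simp add: ergodic_measure_def ergodic_prob_def)
  have inv_m: "invariant_prob ?S shift (m i)" if "i \<in> I" for i
    using m[OF that] by (simp add: ergodic_measure_def ergodic_prob_def)
  interpret \<mu>: prob_space \<mu> by (rule invariant_probD(1)[OF inv_\<mu>])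
  have "\<exists>E\<in>sets ?S. measure \<mu> E = 1 \<and> measure (m i) E = 0" if i: "i \<in> I" for i
    by (rule ergodic_mutually_singular[of ?S shift \<mu> "m i" "translate (- 1)"])
       (use \<mu> m[OF i] ne[OF i] translate_measurable[OF X] in \<open>auto simp: ergodic_measure_def shift_eq_translate\<close>)
  then obtain E where E: "\<And>i. i \<in> I \<Longrightarrow> E i \<in> sets ?S"
    "\<And>i. i \<in> I \<Longrightarrow> measure \<mu> (E i) = 1" "\<And>i. i \<in> I \<Longrightarrow> measure (m i) (E i) = 0"
    by metis
  define F where "F = X \<inter> (\<Inter>i\<in>I. E i)"
  have F_eq: "F = {x \<in> space ?S. \<forall>i\<in>I. x \<in> E i}" by (auto simp: F_def)
  have F: "F \<in> sets ?S" unfolding F_eq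
  proof (intro sets.sets_Collect_finite_All)
    fix i assume i: "i \<in> I"
    have "{x \<in> space ?S. x \<in> E i} = E i" using sets.sets_into_space[OF E(1)[OF i]] by auto
    then show "{x \<in> space ?S. x \<in> E i} \<in> sets ?S" using E(1)[OF i] by simp
  qed (rule I)
  have setsS: "sets \<mu> = sets ?S" "\<And>i. i \<in> I \<Longrightarrow> sets (m i) = sets ?S"
    using invariant_probD(2)[OF inv_\<mu>] invariant_probD(2)[OF inv_m] by auto
  have "AE x in \<mu>. \<forall>i\<in>I. x \<in> E i"
    using I E(1,2) setsS by (intro AE_finite_allI \<mu>.AE_prob_1) auto
  then have "AE x in \<mu>. x \<in> F"
    using AE_space by eventually_elim (use sets_eq_imp_space_eq[OF setsS(1)] in \<open>auto simp: F_def\<close>)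
  then have \<mu>F: "measure \<mu> F = 1" using F setsS by (simp add: \<mu>.prob_eq_1)
  have mF: "measure (m i) F = 0" if i: "i \<in> I" for i
  proof -
    interpret mi: prob_space "m i" by (rule invariant_probD(1)[OF inv_m[OF i]])
    have "measure (m i) F \<le> measure (m i) (E i)"
      using i E(1)[OF i] setsS(2)[OF i] by (intro mi.finite_measure_mono) (auto simp: F_def)
    then show ?thesis using E(3)[OF i] by (simp add: measure_le_0_iff)
  qed
  \<comment> \<open>Each of the \<open>card I + 1\<close> measures contributes an error below \<open>e\<close>, which adds up to \<open>1 / 2\<close>.\<close>
  define e where "e = 1 / (2 + 2 * real (card I))"
  have e: "0 < e" by (simp add: e_def add_pos_nonneg)
  define M where "M j = (case j of None \<Rightarrow> \<mu> | Some i \<Rightarrow> m i)" for j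
  have "\<exists>C\<in>clopen_subsets X. \<forall>j\<in>insert None (Some ` I). measure (M j) ((F - C) \<union> (C - F)) < e"
  proof (rule approximate_by_algebra[OF algebra_clopen_subsets])
    show "closed X" using X by (simp add: shift_space_def)
    show "finite (insert None (Some ` I))" using I by simp
    show "F \<in> sigma_sets X (clopen_subsets X)" using F sets_borel_on_clopen[OF X] by simp
    fix j assume j: "j \<in> insert None (Some ` I)"
    then show "finite_measure (M j)"
      using invariant_probD(1)[OF inv_m] by (auto simp: M_def \<mu>.finite_measure_axioms prob_space.finite_measure)
    show "sets (M j) = sigma_sets X (clopen_subsets X)"
      using j setsS by (auto simp: M_def sets_borel_on_clopen[OF X])
  qed (rule e)
  then obtain C where C: "C \<in> clopen_subsets X"
    and app: "\<And>j. j \<in> insert None (Some ` I) \<Longrightarrow> measure (M j) ((F - C) \<union> (C - F)) < e" by blast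
  have CS: "closed C" "C \<subseteq> X" "C \<in> sets ?S" using C by (auto simp: clopen_subsets_def intro: closed_subset_borel_on)
  have "1 = measure \<mu> F" by (simp add: \<mu>F)
  also have "\<dots> \<le> measure \<mu> (C \<union> ((F - C) \<union> (C - F)))"
    using CS F setsS by (intro \<mu>.finite_measure_mono) auto
  also have "\<dots> \<le> measure \<mu> C + measure \<mu> ((F - C) \<union> (C - F))"
    using CS F setsS by (intro measure_Un_le) auto
  also have "measure \<mu> ((F - C) \<union> (C - F)) < e" using app[of None] by (simp add: M_def)
  also have "measure \<mu> C \<le> (\<Sum>i\<in>I. measure (m i) C)" using CS by (intro le)
  also have "\<dots> \<le> (\<Sum>i\<in>I. e)"
  proof (rule sum_mono)
    fix i assume i: "i \<in> I"
    interpret mi: prob_space "m i" by (rule invariant_probD(1)[OF inv_m[OF i]])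
    have "measure (m i) C \<le> measure (m i) (F \<union> ((F - C) \<union> (C - F)))"
      using CS F setsS(2)[OF i] by (intro mi.finite_measure_mono) auto
    also have "\<dots> \<le> measure (m i) F + measure (m i) ((F - C) \<union> (C - F))"
      using CS F setsS(2)[OF i] by (intro measure_Un_le) auto
    also have "\<dots> \<le> e" using app[of "Some i"] i by (simp add: M_def mF)
    finally show "measure (m i) C \<le> e" .
  qed
  finally have "1 < (\<Sum>i\<in>I. e) + e" by simp
  moreover have "(\<Sum>i\<in>I. e) + e = 1 / 2" by (simp add: e_def field_simps)
  ultimately show False by simp
qed

theorem theorem4p4:
  fixes X :: "(int \<Rightarrow> 'a::discrete_topology) set"
    and Y :: "(int \<Rightarrow> 'b::discrete_topology) set"
    and \<pi> :: "(int \<Rightarrow> 'a) \<Rightarrow> int \<Rightarrow> 'b"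
    and \<nu> :: "(int \<Rightarrow> 'b) measure"
    and \<Lambda> :: "(nat \<Rightarrow> int \<Rightarrow> 'a) measure"
  assumes "sofic X" and "irreducible_shift X"
    and "factor_code X Y \<pi>" and "finite_to_one X Y \<pi>"
    and "ergodic_measure Y \<nu>" and "fully_supported Y \<nu>"
    and "degree_joining X Y \<pi> \<nu> \<Lambda>"
  shows "{margin X i \<Lambda> |i. 1 \<le> i \<and> i \<le> code_degree X Y \<pi>} =
         {\<mu>. ergodic_measure X \<mu> \<and> distr \<mu> (borel_on Y) \<pi> = \<nu>}"
proof -
  have X: "shift_space X" and Y: "shift_space Y" and cont: "continuous_on X \<pi>" and surj: "\<pi> ` X = Y"
    using assms(3) by (auto simp: factor_code_def)
  have dt: "AE y in \<nu>. doubly_transitive Y y" by (rule AE_doubly_transitive[OF Y assms(5,6)])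
  have inv_\<nu>: "invariant_prob (borel_on Y) shift \<nu>"
    using assms(5) by (simp add: ergodic_measure_def ergodic_prob_def)
  interpret \<nu>: prob_space \<nu> by (rule invariant_probD(1)[OF inv_\<nu>])
  have "\<exists>y. doubly_transitive Y y"
  proof (rule ccontr)
    assume "\<not> (\<exists>y. doubly_transitive Y y)"
    then have "AE y in \<nu>. False" using dt by simp
    then show False by simp
  qed
  then obtain y1 where y1: "doubly_transitive Y y1" by blast
  then have "X \<noteq> {}" using surj by (auto simp: doubly_transitive_def)
  then obtain d' where d': "\<And>y. doubly_transitive Y y \<Longrightarrow> card (fiber X \<pi> y) = d'"
    using card_fiber_doubly_transitive_constant[OF assms(1-4)] by blast
  have fin: "finite (fiber X \<pi> y)" if "y \<in> Y" for y using assms(4) that by (auto simp: finite_to_one_def)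
  define d where "d = code_degree X Y \<pi>"
  have "d = d'"
    unfolding d_def code_degree_def
  proof (rule the_equality)
    show "\<forall>y. doubly_transitive Y y \<longrightarrow> finite (fiber X \<pi> y) \<and> card (fiber X \<pi> y) = d'"
      using d' fin by (auto simp: doubly_transitive_def)
  qed (use y1 d' in blast)
  then have card_fiber: "card (fiber X \<pi> y) = d" if "doubly_transitive Y y" for y using d' that by simp
  have rel: "relative_joining_over X Y \<pi> d \<nu> \<Lambda>" and sep: "AE z in \<Lambda>. inj_on z {1..d}"
    and erg: "ergodic_prob (borel_power X d) (diagonal_shift d) \<Lambda>"
    using assms(7) unfolding degree_joining_def d_def[symmetric] Let_def separating_def by auto
  then obtain i0 where i0: "i0 \<in> {1..d}" "distr (margin X i0 \<Lambda>) (borel_on Y) \<pi> = \<nu>"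
    and same: "AE z in \<Lambda>. \<forall>i\<in>{1..d}. \<forall>j\<in>{1..d}. \<pi> (z i) = \<pi> (z j)"
    by (auto simp: relative_joining_over_def relative_joining_def)
  have inv: "invariant_prob (borel_power X d) (diagonal_shift d) \<Lambda>" using erg by (simp add: ergodic_prob_def)
  note D = invariant_probD[OF inv]
  have p: "(\<lambda>z. z i) \<in> measurable \<Lambda> (borel_on X)" if "i \<in> {1..d}" for i
  proof -
    have "(\<lambda>z. z i) \<in> measurable (borel_power X d) (borel_on X)"
      unfolding borel_power_def using that by measurable
    then show ?thesis using D(2) by (metis measurable_cong_sets)
  qed
  have m\<pi>: "\<pi> \<in> measurable (borel_on X) (borel_on Y)"
    using cont surj by (intro continuous_measurable_borel_on) auto
  have over: "distr (margin X i \<Lambda>) (borel_on Y) \<pi> = distr \<Lambda> (borel_on Y) (\<lambda>z. \<pi> (z i))" if "i \<in> {1..d}" for i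
    unfolding margin_def distr_distr[OF m\<pi> p[OF that]] by (simp add: o_def)
  have over_\<nu>: "distr (margin X i \<Lambda>) (borel_on Y) \<pi> = \<nu>" if i: "i \<in> {1..d}" for i
  proof -
    have "distr \<Lambda> (borel_on Y) (\<lambda>z. \<pi> (z i)) = distr \<Lambda> (borel_on Y) (\<lambda>z. \<pi> (z i0))"
    proof (rule distr_cong_AE)
      show "AE z in \<Lambda>. \<pi> (z i) = \<pi> (z i0)" using same by eventually_elim (use i i0(1) in blast)
    qed (use measurable_compose[OF p[OF i] m\<pi>] measurable_compose[OF p[OF i0(1)] m\<pi>] in simp_all)
    then show ?thesis using over[OF i] over[OF i0(1)] i0(2) by simp
  qed
  have "AE z in \<Lambda>. doubly_transitive Y (\<pi> (z i0))"
    using dt unfolding i0(2)[symmetric] over[OF i0(1)]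
    by (rule AE_distrD[OF measurable_compose[OF p[OF i0(1)] m\<pi>]])
  then have fib: "AE z in \<Lambda>. fiber X \<pi> (\<pi> (z i0)) \<subseteq> z ` {1..d}"
    using same sep AE_space
  proof eventually_elim
    case (elim z)
    have "z ` {1..d} \<subseteq> fiber X \<pi> (\<pi> (z i0))"
    proof (rule image_subsetI)
      fix i assume i: "i \<in> {1..d}"
      have "z i \<in> X" using measurable_space[OF p[OF i] elim(4)] by simp
      moreover have "\<pi> (z i) = \<pi> (z i0)" using elim(2) i i0(1) by blast
      ultimately show "z i \<in> fiber X \<pi> (\<pi> (z i0))" by (simp add: fiber_def)
    qed
    moreover have "card (z ` {1..d}) = card (fiber X \<pi> (\<pi> (z i0)))"
      using card_image[OF elim(3)] card_fiber[OF elim(1)] by simp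
    moreover have "finite (fiber X \<pi> (\<pi> (z i0)))" using fin elim(1) by (simp add: doubly_transitive_def)
    ultimately show ?case using card_subset_eq by blast
  qed
  have margins: "ergodic_measure X (margin X i \<Lambda>)" if "i \<in> {1..d}" for i
    by (rule margin_ergodic[OF X erg that])
  have "\<exists>i\<in>{1..d}. \<mu> = margin X i \<Lambda>"
    if \<mu>: "ergodic_measure X \<mu>" "distr \<mu> (borel_on Y) \<pi> = \<nu>" for \<mu>
  proof (rule ergodic_dominated_by_finite_sum[OF X \<mu>(1) _ margins])
    have "invariant_prob (borel_on X) shift \<mu>"
      using \<mu>(1) by (simp add: ergodic_measure_def ergodic_prob_def)
    note D\<mu> = invariant_probD[OF this]
    show "measure \<mu> C \<le> (\<Sum>i\<in>{1..d}. measure (margin X i \<Lambda>) C)" if "closed C" "C \<subseteq> X" for C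
      using measure_le_sum_margins[OF assms(3) i0(1) _ D(1) p i0(2) fib D\<mu>(1,2) \<mu>(2) that] by simp
  qed simp_all
  then have "{margin X i \<Lambda> |i. i \<in> {1..d}} =
      {\<mu>. ergodic_measure X \<mu> \<and> distr \<mu> (borel_on Y) \<pi> = \<nu>}"
    using margins over_\<nu> by blast
  then show ?thesis by (simp only: d_def atLeastAtMost_iff)
qed

end
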